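(* Let $\mathbb{R}^3_+=\{x\in\mathbb{R}^3:x_3>0\}$. Let $(\mathbf{u},\mathbf{B})$ be a smooth (up to $\partial\mathbb{R}^3_+\setminus\{0\}$) axisymmetric self-similar solution in $\mathbb{R}^3_+$ of the stationary MHD system $$-\Delta \mathbf{u} + (\mathbf{u}\cdot\nabla)\mathbf{u} - (\mathbf{B}\cdot\nabla)\mathbf{B} + \nabla p = 0,\qquad -\Delta \mathbf{B} + (\mathbf{u}\cdot\nabla)\mathbf{B} - (\mathbf{B}\cdot\nabla)\mathbf{u} = 0,\qquad \nabla\cdot\mathbf{u}=\nabla\cdot\mathbf{B}=0,$$ (with a smooth scalar pressure $p$) of the form $\mathbf{u}=u^r(r,z)\mathbf{e}_r+u^\theta(r,z)\mathbf{e}_\theta+u^z(r,z)\mathbf{e}_z$ and $\mathbf{B}=B^\theta(r,z)\mathbf{e}_\theta$ in cylindrical coordinates, satisfying either the no-slip boundary condition $$\mathbf{u}=0,\quad \mathbf{B}\cdot\mathbf{n}=0,\quad \operatorname{curl}\mathbf{B}\times\mathbf{n}=0\quad\text{on }\partial\mathbb{R}^3_+\setminus\{0\},$$ or the Navier slip boundary condition $$\mathbf{u}\cdot\mathbf{n}=0,\quad (\mathbb{D}\mathbf{u}\cdot\mathbf{n})\cdot\boldsymbol{\tau}=0,\quad \mathbf{B}\cdot\mathbf{n}=0,\quad \operatorname{curl}\mathbf{B}\times\mathbf{n}=0\quad\text{on }\partial\mathbb{R}^3_+\setminus\{0\}.$$ Suppose that $u^r(r,z)<\frac{1}{3r}+\frac{2r}{3}$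 on $\partial B_1\cap\mathbb{R}^3_+$ (at points with $r>0$), where $\partial B_1=\{x\in\mathbb{R}^3:|x|=1\}$. Then $\mathbf{u}=\mathbf{B}=0$.
   Context: Cylindrical coordinates $(r,\theta,z)$: $(x_1,x_2,x_3)=(r\cos\theta,r\sin\theta,z)$, with $\mathbf{e}_r=(\cos\theta,\sin\theta,0)$, $\mathbf{e}_\theta=(-\sin\theta,\cos\theta,0)$, $\mathbf{e}_z=(0,0,1)$. A vector field $\mathbf{w}$ is axisymmetric if $\mathbf{w}=w^r(r,z)\mathbf{e}_r+w^\theta(r,z)\mathbf{e}_\theta+w^z(r,z)\mathbf{e}_z$. Self-similar: $(\mathbf{u},\mathbf{B},p)$ is self-similar if for all $\lambda>0$ and all $x$ in the domain, $\mathbf{u}(x)=\lambda\mathbf{u}(\lambda x)$, $\mathbf{B}(x)=\lambda\mathbf{B}(\lambda x)$, $p(x)=\lambda^2p(\lambda x)$. Saying that $(\mathbf{u},\mathbf{B})$ is a smooth self-similar solution means that there is a smooth $p$ such that the system holds and $(\mathbf{u},\mathbf{B},p)$ is self-similar. $\mathbf{n}=-\mathbf{e}_z$ is the unit outward normal on $\partial\mathbb{R}^3_+$, $\boldsymbol{\tau}$ denotes unit tangent vectors to $\partial\mathbb{R}^3_+$ (the condition holds for every such $\boldsymbol{\tau}$), and $\mathbb{D}\mathbf{u}=\frac12(\nabla\mathbf{u}+\nabla\mathbf{u}^T)$ is the strain tensor. *)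

theory Defs
  imports "HOL-Analysis.Analysis"
begin

definition half_space :: "(real^3) set" where
  "half_space = {x. x $ 3 > 0}"

definition half_space_boundary :: "(real^3) set" where
  "half_space_boundary = {x. x $ 3 = 0} - {0}"

definition half_space_closed :: "(real^3) set" where
  "half_space_closed = half_space \<union> half_space_boundary"


text \<open>
  All differential operators take the set \<open>S\<close> relative to which derivatives are formed. For
  open \<open>S\<close> these are the ordinary derivatives at points of \<open>S\<close>. For
  \<^const>\<open>half_space_closed\<close> they are the ordinary derivatives at interior points and the
  one-sided ones at boundary points; the derivative within this set is unique.
\<close>

definition partial :: "(real^3) set \<Rightarrow> 3 \<Rightarrow> (real^3 \<Rightarrow> 'b::real_normed_vector) \<Rightarrow> real^3 \<Rightarrow> 'b" where
  "partial S i f x = frechet_derivative f (at x within S) (axis i 1)"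

primrec C_k_on :: "nat \<Rightarrow> (real^3) set \<Rightarrow> (real^3 \<Rightarrow> 'b::real_normed_vector) \<Rightarrow> bool" where
  "C_k_on 0 S f \<longleftrightarrow> continuous_on S f"
| "C_k_on (Suc k) S f \<longleftrightarrow> f differentiable_on S \<and> (\<forall>i. C_k_on k S (partial S i f))"

text \<open>
  On \<^const>\<open>half_space_closed\<close> this is smoothness up to the boundary away from the origin: all
  partial derivatives in the open half space extend continuously to the punctured boundary.
\<close>

definition smooth_on :: "(real^3) set \<Rightarrow> (real^3 \<Rightarrow> 'b::real_normed_vector) \<Rightarrow> bool" where
  "smooth_on S f \<longleftrightarrow> (\<forall>k. C_k_on k S f)"

definition gradient :: "(real^3) set \<Rightarrow> (real^3 \<Rightarrow> real) \<Rightarrow> real^3 \<Rightarrow> real^3" where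
  "gradient S f x = (\<chi> i. partial S i f x)"

definition divergence :: "(real^3) set \<Rightarrow> (real^3 \<Rightarrow> real^3) \<Rightarrow> real^3 \<Rightarrow> real" where
  "divergence S w x = (\<Sum>i\<in>UNIV. partial S i w x $ i)"

definition laplacian :: "(real^3) set \<Rightarrow> (real^3 \<Rightarrow> real^3) \<Rightarrow> real^3 \<Rightarrow> real^3" where
  "laplacian S w x = (\<Sum>i\<in>UNIV. partial S i (partial S i w) x)"

definition advection :: "(real^3) set \<Rightarrow> (real^3 \<Rightarrow> real^3) \<Rightarrow> (real^3 \<Rightarrow> real^3) \<Rightarrow> real^3 \<Rightarrow> real^3" where
  "advection S v w x = (\<Sum>i\<in>UNIV. v x $ i *\<^sub>R partial S i w x)"

definition curl :: "(real^3) set \<Rightarrow> (real^3 \<Rightarrow> real^3) \<Rightarrow> real^3 \<Rightarrow> real^3" where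
  "curl S w x = vector
    [partial S 2 w x $ 3 - partial S 3 w x $ 2,
     partial S 3 w x $ 1 - partial S 1 w x $ 3,
     partial S 1 w x $ 2 - partial S 2 w x $ 1]"

definition strain :: "(real^3) set \<Rightarrow> (real^3 \<Rightarrow> real^3) \<Rightarrow> real^3 \<Rightarrow> real^3^3" where
  "strain S w x = (1/2) *\<^sub>R
     (jacobian w (at x within S) + transpose (jacobian w (at x within S)))"


definition cyl_point :: "real \<Rightarrow> real \<Rightarrow> real \<Rightarrow> real^3" where
  "cyl_point r \<theta> z = vector [r * cos \<theta>, r * sin \<theta>, z]"

definition e_r :: "real \<Rightarrow> real^3" where
  "e_r \<theta> = vector [cos \<theta>, sin \<theta>, 0]"

definition e_theta :: "real \<Rightarrow> real^3" where
  "e_theta \<theta> = vector [- sin \<theta>, cos \<theta>, 0]"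

definition e_z :: "real^3" where
  "e_z = vector [0, 0, 1]"

text \<open>
  The representation is required off the axis only, since \<^const>\<open>e_r\<close> and
  \<^const>\<open>e_theta\<close> are not determined by the point at \<open>r = 0\<close>.
\<close>

definition axisymmetric_with ::
  "(real^3 \<Rightarrow> real^3) \<Rightarrow> (real \<Rightarrow> real \<Rightarrow> real) \<Rightarrow> (real \<Rightarrow> real \<Rightarrow> real) \<Rightarrow> (real \<Rightarrow> real \<Rightarrow> real) \<Rightarrow> bool" where
  "axisymmetric_with w wr wt wz \<longleftrightarrow>
     (\<forall>r>0. \<forall>\<theta>. \<forall>z>0. w (cyl_point r \<theta> z) =
        wr r z *\<^sub>R e_r \<theta> + wt r z *\<^sub>R e_theta \<theta> + wz r z *\<^sub>R e_z)"


definition mhd_system ::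
  "(real^3 \<Rightarrow> real^3) \<Rightarrow> (real^3 \<Rightarrow> real^3) \<Rightarrow> (real^3 \<Rightarrow> real) \<Rightarrow> bool" where
  "mhd_system u B p \<longleftrightarrow> (\<forall>x\<in>half_space.
      - laplacian half_space u x + advection half_space u u x
        - advection half_space B B x + gradient half_space p x = 0
    \<and> - laplacian half_space B x + advection half_space u B x
        - advection half_space B u x = 0
    \<and> divergence half_space u x = 0
    \<and> divergence half_space B x = 0)"

definition self_similar ::
  "(real^3 \<Rightarrow> real^3) \<Rightarrow> (real^3 \<Rightarrow> real^3) \<Rightarrow> (real^3 \<Rightarrow> real) \<Rightarrow> bool" where
  "self_similar u B p \<longleftrightarrow> (\<forall>\<mu>>0. \<forall>x\<in>half_space.
      u x = \<mu> *\<^sub>R u (\<mu> *\<^sub>R x) \<and> B x = \<mu> *\<^sub>R B (\<mu> *\<^sub>R x) \<and> p x = \<mu>\<^sup>2 * p (\<mu> *\<^sub>R x))"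

text \<open>
  The pressure is only required to be smooth in the open half space. The momentum equation
  and the homogeneity of \<open>p\<close> then yield its smooth extension to the punctured boundary.
\<close>

definition smooth_self_similar_solution ::
  "(real^3 \<Rightarrow> real^3) \<Rightarrow> (real^3 \<Rightarrow> real^3) \<Rightarrow> bool" where
  "smooth_self_similar_solution u B \<longleftrightarrow>
     smooth_on half_space_closed u \<and> smooth_on half_space_closed B \<and>
     (\<exists>p. smooth_on half_space p \<and> mhd_system u B p \<and> self_similar u B p)"


definition outward_normal :: "real^3" where
  "outward_normal = - e_z"

definition magnetic_bc :: "(real^3 \<Rightarrow> real^3) \<Rightarrow> bool" where
  "magnetic_bc B \<longleftrightarrow> (\<forall>x\<in>half_space_boundary.
      B x \<bullet> outward_normal = 0 \<and>
      cross3 (curl half_space_closed B x) outward_normal = 0)"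

definition no_slip_bc :: "(real^3 \<Rightarrow> real^3) \<Rightarrow> (real^3 \<Rightarrow> real^3) \<Rightarrow> bool" where
  "no_slip_bc u B \<longleftrightarrow> (\<forall>x\<in>half_space_boundary. u x = 0) \<and> magnetic_bc B"

definition navier_slip_bc :: "(real^3 \<Rightarrow> real^3) \<Rightarrow> (real^3 \<Rightarrow> real^3) \<Rightarrow> bool" where
  "navier_slip_bc u B \<longleftrightarrow> (\<forall>x\<in>half_space_boundary.
      u x \<bullet> outward_normal = 0 \<and>
      (\<forall>\<tau>. norm \<tau> = 1 \<and> \<tau> \<bullet> outward_normal = 0 \<longrightarrow>
         (strain half_space_closed u x *v outward_normal) \<bullet> \<tau> = 0)) \<and> magnetic_bc B"

end

theory Submission
  imports Defs "HOL-Real_Asymp.Real_Asymp"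
begin

text \<open>
  Homogeneity and axisymmetry determine all fields by their values at the points \<open>(1, 0, z)\<close>,
  \<open>z > 0\<close>. Write \<open>u = (a, b, c)\<close>, \<open>B = (0, k, 0)\<close> and \<open>p = q\<close> there, and put \<open>m = c - z a\<close>, so
  that \<open>m' = - a\<close> by incompressibility. The point \<open>z = 0\<close> is the boundary and \<open>z \<rightarrow> \<infinity>\<close> is the
  axis, where smoothness gives decay.

  The magnetic field: \<open>H = (1 + z\<^sup>2) k k' + 3/2 z k\<^sup>2 - m k\<^sup>2 / 2\<close> vanishes at \<open>0\<close> and at infinity,
  and the bound on the radial velocity, which reads \<open>a < 1/3 + 2/(3 (1 + z\<^sup>2))\<close>, is exactly what
  makes \<open>H\<close> nondecreasing and strictly increasing where \<open>k \<noteq> 0\<close>. The swirl: \<open>b'\<close> solves a linear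
  first order equation and has a zero, by Rolle's theorem (no slip) or at \<open>z = 0\<close> (slip). The remaining
  flow: \<open>n = q - 2 a\<close> satisfies \<open>(1 + z\<^sup>2) n'' + 3 z n' = 0\<close>, and
  \<open>N = (1 + z\<^sup>2) m' + z m - m\<^sup>2 / 2\<close> equals \<open>(1 + z\<^sup>2) n\<close> up to a constant. Decay of \<open>N\<close> at infinity and
  the boundary condition force \<open>N = 0\<close>, a Riccati equation whose solution with \<open>m 0 = 0\<close> is \<open>0\<close>.
\<close>

section \<open>Ordinary differential equations on the half line\<close>

text \<open>The integrating factor \<open>exp (- H)\<close>, with \<open>H\<close> a primitive of
  \<open>h\<close>, turns \<open>w\<close> into a constant, so a zero at one point spreads in both
  directions. Continuity up to 0 lets that zero sit at the end point, where no derivative is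
  assumed.\<close>

lemma linear_ode_zero:
  fixes w h :: "real \<Rightarrow> real"
  assumes w: "continuous_on {0..} w" and h: "continuous_on {0..} h"
    and ode: "\<And>z. z > 0 \<Longrightarrow> (w has_real_derivative h z * w z) (at z)"
    and "z\<^sub>0 \<ge> 0" "w z\<^sub>0 = 0" "z \<ge> 0"
  shows "w z = 0"
proof -
  define R where "R = max z z\<^sub>0 + 1"
  define H where "H = (\<lambda>x. integral {0..x} h)"
  define g where "g = (\<lambda>x. w x * exp (- H x))"
  have hR: "continuous_on {0..R} h"
    using h by (rule continuous_on_subset) auto
  have H: "(H has_real_derivative h x) (at x within {0..R})" if "x \<in> {0..R}" for x
    using integral_has_real_derivative[of 0 R h x, OF hR that] by (simp only: H_def)
  have "continuous_on {0..R} H"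
    by (rule DERIV_continuous_on[OF H])
  then have "continuous_on {0..R} g"
    unfolding g_def by (intro continuous_intros continuous_on_subset[OF w]) auto
  note contg = this
  have g': "(g has_real_derivative 0) (at x)" if "0 < x" "x < R" for x
  proof -
    have "at x within {0..R} = at x"
      using that by (simp add: at_within_Icc_at)
    then have "(H has_real_derivative h x) (at x)"
      using H[of x] that by simp
    then show ?thesis
      unfolding g_def using ode[OF that(1)]
      by (auto intro!: derivative_eq_intros simp: algebra_simps)
  qed
  have R: "0 < R" "z \<le> R" "z\<^sub>0 \<le> R"
    using assms by (auto simp: R_def)
  have "g z = g 0" "g z\<^sub>0 = g 0"
    by (rule DERIV_isconst2[OF R(1) contg g']; use assms R in simp)+
  then show ?thesis
    using \<open>w z\<^sub>0 = 0\<close> by (simp add: g_def)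
qed

lemma constant_of_zero_derivative_pos:
  fixes f :: "real \<Rightarrow> real"
  assumes "\<And>z. z > 0 \<Longrightarrow> (f has_real_derivative 0) (at z)" "z > 0"
  shows "f z = f 1"
proof -
  have "\<exists>c. \<forall>x\<in>{0<..}. f x = c"
    using assms(1)
    by (intro has_field_derivative_zero_constant) (auto intro: has_field_derivative_at_within)
  then show ?thesis
    using assms(2) by (metis greaterThan_iff zero_less_one)
qed

text \<open>Multiplying the equation by \<open>k\<close> and collecting exact derivatives gives
  \<open>H\<close>. A nondecreasing function that starts at 0 and tends to 0 is constant, so
  \<open>H'\<close> vanishes, and in \<open>H'\<close> the factor of \<open>k\<close> squared is
  strictly positive.\<close>

lemma magnetic_ode_zero:
  fixes a m k k1 k2 :: "real \<Rightarrow> real"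
  assumes cont: "continuous_on {0..} m" "continuous_on {0..} k" "continuous_on {0..} k1"
    and m: "\<And>z. z > 0 \<Longrightarrow> (m has_real_derivative - a z) (at z)"
    and k: "\<And>z. z > 0 \<Longrightarrow> (k has_real_derivative k1 z) (at z)"
    and k1: "\<And>z. z > 0 \<Longrightarrow> (k1 has_real_derivative k2 z) (at z)"
    and ode: "\<And>z. z > 0 \<Longrightarrow> (1 + z\<^sup>2) * k2 z + 3 * z * k1 z = m z * k1 z - 2 * a z * k z"
    and bc: "k1 0 = 0" "m 0 = 0"
    and lim: "(m \<longlongrightarrow> 0) at_top" "((\<lambda>z. z\<^sup>2 * k z) \<longlongrightarrow> \<kappa>) at_top" "((\<lambda>z. z\<^sup>2 * k1 z) \<longlongrightarrow> \<kappa>') at_top"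
    and less: "\<And>z. z > 0 \<Longrightarrow> a z < 1 / 3 + 2 / (3 * (1 + z\<^sup>2))"
    and "z > 0"
  shows "k z = 0"
proof -
  define H where "H = (\<lambda>z. (1 + z\<^sup>2) * k z * k1 z + 3 / 2 * z * (k z)\<^sup>2 - m z * (k z)\<^sup>2 / 2)"
  \<comment> \<open>The square is completed in (1 + z^2) k1^2 + 2 z k k1 + k^2; what is left over is
    k^2 / (1 + z^2), which joins the second summand.\<close>
  define H' where "H' = (\<lambda>z. ((1 + z\<^sup>2) * k1 z + z * k z)\<^sup>2 / (1 + z\<^sup>2)
      + (k z)\<^sup>2 * (1 / 2 + 1 / (1 + z\<^sup>2) - 3 / 2 * a z))"
  have pos: "1 + z\<^sup>2 > 0" for z :: real
    by (simp add: add_pos_nonneg)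
  have H: "(H has_real_derivative H' z) (at z)" if "z > 0" for z
  proof -
    have eq: "(1 + z\<^sup>2) * k2 z = m z * k1 z - 2 * a z * k z - 3 * z * k1 z"
      using ode[OF that] by linarith
    have sq: "((1 + z\<^sup>2) * k1 z + z * k z)\<^sup>2 / (1 + z\<^sup>2) + (k z)\<^sup>2 * (1 / (1 + z\<^sup>2))
        = (1 + z\<^sup>2) * (k1 z)\<^sup>2 + 2 * z * k z * k1 z + (k z)\<^sup>2"
      using pos[of z] by (simp add: divide_simps) algebra
    have "H' z = (1 + z\<^sup>2) * (k1 z)\<^sup>2 + 2 * z * k z * k1 z + (k z)\<^sup>2 + (k z)\<^sup>2 * (1 / 2 - 3 / 2 * a z)"
      unfolding H'_def sq[symmetric] by (simp add: algebra_simps)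
    moreover have "(H has_real_derivative
      (2 * z * k z * k1 z + (1 + z\<^sup>2) * (k1 z)\<^sup>2 + k z * ((1 + z\<^sup>2) * k2 z)
       + 3 / 2 * (k z)\<^sup>2 + 3 * z * k z * k1 z + a z * (k z)\<^sup>2 / 2 - m z * k z * k1 z)) (at z)"
      unfolding H_def using m[OF that] k[OF that] k1[OF that]
      by (auto intro!: derivative_eq_intros simp: field_simps power2_eq_square)
    moreover have "(2 * z * k z * k1 z + (1 + z\<^sup>2) * (k1 z)\<^sup>2 + k z * ((1 + z\<^sup>2) * k2 z)
       + 3 / 2 * (k z)\<^sup>2 + 3 * z * k z * k1 z + a z * (k z)\<^sup>2 / 2 - m z * k z * k1 z)
      = (1 + z\<^sup>2) * (k1 z)\<^sup>2 + 2 * z * k z * k1 z + (k z)\<^sup>2 + (k z)\<^sup>2 * (1 / 2 - 3 / 2 * a z)"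
      unfolding eq by (simp add: algebra_simps power2_eq_square)
    ultimately show ?thesis
      by (simp only:)
  qed
  have gap: "1 / 2 + 1 / (1 + z\<^sup>2) - 3 / 2 * a z > 0" if "z > 0" for z
  proof -
    have "3 / 2 * a z < 3 / 2 * (1 / 3 + 2 / (3 * (1 + z\<^sup>2)))"
      using less[OF that] by simp
    also have "\<dots> = 1 / 2 + 1 / (1 + z\<^sup>2)"
      using pos[of z] by (simp add: field_simps)
    finally show ?thesis by simp
  qed
  have H'_nonneg: "H' z \<ge> 0" if "z > 0" for z
    unfolding H'_def using gap[OF that] pos[of z] by auto
  have contH: "continuous_on {0..} H"
    unfolding H_def by (intro continuous_intros cont) auto
  have mono: "H x \<le> H y" if "0 \<le> x" "x \<le> y" for x y
  proof (rule DERIV_nonneg_imp_increasing_open[OF that(2)])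
    show "\<exists>y. (H has_real_derivative y) (at t) \<and> y \<ge> 0" if "x < t" for t
      using H[of t] H'_nonneg[of t] that \<open>0 \<le> x\<close> by (intro exI[of _ "H' t"]) simp
    show "continuous_on {x..y} H"
      using that by (intro continuous_on_subset[OF contH]) auto
  qed
  have zz: "((\<lambda>z::real. 1 / z\<^sup>2) \<longlongrightarrow> 0) at_top" "((\<lambda>z::real. (1 + z\<^sup>2) / z\<^sup>2) \<longlongrightarrow> 1) at_top"
    "((\<lambda>z::real. z / z\<^sup>2) \<longlongrightarrow> 0) at_top"
    by (real_asymp, real_asymp, real_asymp)
  \<comment> \<open>Each term of \<open>H\<close> is written as a product of the convergent
    quantities \<open>z\<^sup>2 * k z\<close>, \<open>z\<^sup>2 * k1 z\<close>, \<open>m z\<close>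
    and rational factors, at least one of which tends to 0.\<close>
  have "((\<lambda>z. (1 + z\<^sup>2) / z\<^sup>2 * (1 / z\<^sup>2) * (z\<^sup>2 * k z) * (z\<^sup>2 * k1 z)
      + 3 / 2 * (z / z\<^sup>2) * (1 / z\<^sup>2) * (z\<^sup>2 * k z)\<^sup>2
      - m z * (1 / z\<^sup>2) * (1 / z\<^sup>2) * (z\<^sup>2 * k z)\<^sup>2 / 2)
    \<longlongrightarrow> 1 * 0 * \<kappa> * \<kappa>' + 3 / 2 * 0 * 0 * \<kappa>\<^sup>2 - 0 * 0 * 0 * \<kappa>\<^sup>2 / 2) at_top"
    by (intro tendsto_intros zz lim) simp
  moreover have "eventually (\<lambda>z. (1 + z\<^sup>2) / z\<^sup>2 * (1 / z\<^sup>2) * (z\<^sup>2 * k z) * (z\<^sup>2 * k1 z)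
      + 3 / 2 * (z / z\<^sup>2) * (1 / z\<^sup>2) * (z\<^sup>2 * k z)\<^sup>2
      - m z * (1 / z\<^sup>2) * (1 / z\<^sup>2) * (z\<^sup>2 * k z)\<^sup>2 / 2 = H z) at_top"
    using eventually_gt_at_top[of 0]
    by eventually_elim (simp add: H_def field_simps power2_eq_square)
  ultimately have limH: "(H \<longlongrightarrow> 0) at_top"
    by (simp add: tendsto_cong)
  have H0: "H x = 0" if "x > 0" for x
  proof (rule antisym)
    have "eventually (\<lambda>y. H x \<le> H y) at_top"
      using eventually_ge_at_top[of x] by eventually_elim (use mono that in simp)
    then show "H x \<le> 0"
      using limH by (intro tendsto_lowerbound[OF limH]) auto
    show "0 \<le> H x"
      using mono[of 0 x] that bc by (simp add: H_def)
  qed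
  \<comment> \<open>\<open>H\<close> vanishes on an open set around \<open>z\<close>, so the
    derivative computed above is 0 there, and with it both nonnegative summands of
    \<open>H'\<close>.\<close>
  have "(H has_real_derivative 0) (at z)"
  proof (rule has_field_derivative_transform_within_open[of "\<lambda>_. 0" _ _ "{0<..}"])
  qed (use H0 \<open>z > 0\<close> in auto)
  then have "H' z = 0"
    using DERIV_unique H[OF \<open>z > 0\<close>] by blast
  moreover have "((1 + z\<^sup>2) * k1 z + z * k z)\<^sup>2 / (1 + z\<^sup>2) \<ge> 0"
    using pos[of z] by simp
  moreover have "(k z)\<^sup>2 * (1 / 2 + 1 / (1 + z\<^sup>2) - 3 / 2 * a z) \<ge> 0"
    using gap[OF \<open>z > 0\<close>] by simp
  ultimately have "(k z)\<^sup>2 * (1 / 2 + 1 / (1 + z\<^sup>2) - 3 / 2 * a z) = 0"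
    unfolding H'_def by linarith
  then show ?thesis
    using gap[OF \<open>z > 0\<close>] by simp
qed

text \<open>The equation is linear of first order in \<open>b1\<close>, so a single zero of
  \<open>b1\<close> makes it vanish identically. Without a zero, \<open>b1\<close> has a fixed sign
  and \<open>b 0 = 0\<close>, and a strictly monotone \<open>b\<close> starting from 0 cannot return
  to 0 at infinity.\<close>

lemma swirl_ode_zero:
  fixes m b b1 b2 :: "real \<Rightarrow> real"
  assumes cont: "continuous_on {0..} m" "continuous_on {0..} b" "continuous_on {0..} b1"
    and b: "\<And>z. z > 0 \<Longrightarrow> (b has_real_derivative b1 z) (at z)"
    and b1: "\<And>z. z > 0 \<Longrightarrow> (b1 has_real_derivative b2 z) (at z)"
    and ode: "\<And>z. z > 0 \<Longrightarrow> (1 + z\<^sup>2) * b2 z + 3 * z * b1 z = m z * b1 z"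
    and bc: "b 0 = 0 \<or> b1 0 = 0"
    and lim: "(b \<longlongrightarrow> 0) at_top"
    and "z > 0"
  shows "b z = 0"
proof -
  have pos: "1 + z\<^sup>2 > 0" "1 + z\<^sup>2 \<noteq> 0" for z :: real
    using zero_le_power2[of z] by linarith+
  have b1': "(b1 has_real_derivative (m z - 3 * z) / (1 + z\<^sup>2) * b1 z) (at z)" if "z > 0" for z
  proof -
    have "b2 z = (m z - 3 * z) / (1 + z\<^sup>2) * b1 z"
      using ode[OF that] pos[of z] by (simp add: field_simps)
    then show ?thesis using b1[OF that] by simp
  qed
  have zero: "b1 z = 0" if "z\<^sub>0 \<ge> 0" "b1 z\<^sub>0 = 0" "z \<ge> 0" for z\<^sub>0 z
    by (rule linear_ode_zero[OF cont(3) _ b1' that]) (auto intro!: continuous_intros cont simp: pos)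
  have "\<exists>z\<^sub>0\<ge>0. b1 z\<^sub>0 = 0"
  proof (rule ccontr)
    assume *: "\<not> (\<exists>z\<^sub>0\<ge>0. b1 z\<^sub>0 = 0)"
    then have "b 0 = 0" using bc by auto
    have sign: "(\<forall>z\<ge>0. b1 z > 0) \<or> (\<forall>z\<ge>0. b1 z < 0)"
    proof (rule ccontr)
      assume "\<not> ?thesis"
      then obtain x y where xy: "x \<ge> 0" "y \<ge> 0" "b1 x \<le> 0" "b1 y \<ge> 0"
        using linorder_not_less by blast
      \<comment> \<open>The image of the half line is connected, so two values of opposite weak sign
        put 0 into it, whatever the order of \<open>x\<close> and \<open>y\<close>.\<close>
      have "connected (b1 ` {0..})"
        by (intro connected_continuous_image cont) auto
      then have "0 \<in> b1 ` {0..}"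
        using xy unfolding connected_iff_interval by (metis atLeast_iff imageI)
      then show False using * by auto
    qed
    have cont': "continuous_on {x..y} b" if "x \<ge> 0" for x y
      using that by (intro continuous_on_subset[OF cont(2)]) auto
    have "b 1 = 0"
    proof (rule ccontr)
      assume "b 1 \<noteq> 0"
      from sign show False
      proof
        assume p: "\<forall>z\<ge>0. b1 z > 0"
        have inc: "b x < b y" if "0 \<le> x" "x < y" for x y
        proof (rule DERIV_pos_imp_increasing_open[OF that(2) _ cont'[OF that(1)]])
          show "\<exists>y. (b has_real_derivative y) (at t) \<and> y > 0" if "x < t" for t
            using b[of t] p that \<open>0 \<le> x\<close> by (intro exI[of _ "b1 t"]) simp
        qed
        \<comment> \<open>Monotonicity keeps \<open>b 1\<close> below the limit 0, while
          \<open>b 1\<close> exceeds \<open>b 0 = 0\<close>.\<close>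
        have "eventually (\<lambda>y. b 1 \<le> b y) at_top"
          using eventually_gt_at_top[of 1] by eventually_elim (use inc[of 1] in force)
        then have "b 1 \<le> 0"
          by (intro tendsto_lowerbound[OF lim]) auto
        then show False using inc[of 0 1] \<open>b 0 = 0\<close> by simp
      next
        assume p: "\<forall>z\<ge>0. b1 z < 0"
        have inc: "b x > b y" if "0 \<le> x" "x < y" for x y
        proof (rule DERIV_neg_imp_decreasing_open[OF that(2) _ cont'[OF that(1)]])
          show "\<exists>y. (b has_real_derivative y) (at t) \<and> y < 0" if "x < t" for t
            using b[of t] p that \<open>0 \<le> x\<close> by (intro exI[of _ "b1 t"]) simp
        qed
        have "eventually (\<lambda>y. b 1 \<ge> b y) at_top"
          using eventually_gt_at_top[of 1] by eventually_elim (use inc[of 1] in force)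
        then have "b 1 \<ge> 0"
          by (intro tendsto_upperbound[OF lim]) auto
        then show False using inc[of 0 1] \<open>b 0 = 0\<close> by simp
      qed
    qed
    obtain l x where "0 < x" "x < 1" "DERIV b x :> l" "b 1 - b 0 = (1 - 0) * l"
      using MVT[of 0 1 b] b continuous_on_subset[OF cont(2), of "{0..1}"]
      by (auto simp: real_differentiable_def)
    then have "b1 x = 0"
      using b[of x] DERIV_unique \<open>b 1 = 0\<close> \<open>b 0 = 0\<close> by fastforce
    then show False using * \<open>0 < x\<close> by force
  qed
  then have "b1 x = 0" if "x \<ge> 0" for x
    using zero that by blast
  then have "(b has_real_derivative 0) (at x)" if "x > 0" for x
    using b[OF that] that by simp
  then have const: "b x = b 1" if "x > 0" for x
    using constant_of_zero_derivative_pos that by blast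
  have "eventually (\<lambda>x. b x = b 1) at_top"
    using eventually_gt_at_top[of 0] by eventually_elim (rule const)
  then have "((\<lambda>_::real. b 1) \<longlongrightarrow> 0) at_top"
    using lim by (simp add: tendsto_cong)
  then have "b 1 = 0"
    by (simp add: tendsto_const_iff)
  then show ?thesis using const[OF \<open>z > 0\<close>] by simp
qed

text \<open>L'Hopital's rule after substituting \<open>z = 1 / t\<close>: the derivative of
  \<open>m (1 / t)\<close> is \<open>(1 / t)\<^sup>2 * a (1 / t)\<close>. That both limits are the
  same \<alpha> makes the terms of order one in \<open>N\<close> cancel at infinity.\<close>

lemma tendsto_times_of_derivative_asymp:
  fixes m a :: "real \<Rightarrow> real"
  assumes m: "\<And>z. z > 0 \<Longrightarrow> (m has_real_derivative - a z) (at z)"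
    and "(m \<longlongrightarrow> 0) at_top" "((\<lambda>z. z\<^sup>2 * a z) \<longlongrightarrow> \<alpha>) at_top"
  shows "((\<lambda>z. z * m z) \<longlongrightarrow> \<alpha>) at_top"
proof -
  have inv: "filterlim (\<lambda>t::real. 1 / t) at_top (at_right 0)"
    using filterlim_inverse_at_top_right by (simp add: inverse_eq_divide)
  have inv': "filterlim (\<lambda>z::real. 1 / z) (at_right 0) at_top"
    using filterlim_inverse_at_right_top by (simp add: inverse_eq_divide)
  have pos: "eventually (\<lambda>t::real. t > 0) (at_right 0)"
    by (simp add: eventually_at_right_less)
  have "((\<lambda>t. m (1 / t) / t) \<longlongrightarrow> \<alpha>) (at_right 0)"
  proof (rule lhopital_right_0)
    show "((\<lambda>t. m (1 / t)) \<longlongrightarrow> 0) (at_right 0)"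
      by (rule filterlim_compose[OF assms(2) inv])
    show "((\<lambda>t::real. t) \<longlongrightarrow> 0) (at_right 0)"
      by (rule tendsto_ident_at)
    show "eventually (\<lambda>t::real. t \<noteq> 0) (at_right 0)"
      using pos by eventually_elim simp
    show "eventually (\<lambda>t::real. 1 \<noteq> (0::real)) (at_right 0)"
      by simp
    show "eventually (\<lambda>t. DERIV (\<lambda>t. m (1 / t)) t :> (1 / t)\<^sup>2 * a (1 / t)) (at_right 0)"
      using pos
    proof eventually_elim
      case (elim t)
      have "((\<lambda>t. 1 / t) has_real_derivative - (1 / t)\<^sup>2) (at t)"
        using elim by (auto intro!: derivative_eq_intros simp: power2_eq_square)
      from DERIV_chain2[OF m this] elim show ?case
        by (simp add: mult.commute)
    qed
    show "eventually (\<lambda>t::real. DERIV (\<lambda>t. t) t :> 1) (at_right 0)"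
      by simp
    show "filterlim (\<lambda>t. (1 / t)\<^sup>2 * a (1 / t) / 1) (nhds \<alpha>) (at_right 0)"
      using filterlim_compose[OF assms(3) inv] by simp
  qed
  from filterlim_compose[OF this inv'] show ?thesis
    by (simp add: mult.commute)
qed

text \<open>The two momentum equations can be integrated explicitly, leaving three constants
  \<open>L\<close>, \<open>K\<close> and \<open>C\<close>. Decay at infinity gives two linear
  relations among them and either boundary condition gives the third.\<close>

lemma navier_stokes_ode_zero:
  fixes a a1 a2 c c1 c2 q q1 :: "real \<Rightarrow> real"
  assumes cont: "continuous_on {0..} a" "continuous_on {0..} a1" "continuous_on {0..} c"
    and a: "\<And>z. z > 0 \<Longrightarrow> (a has_real_derivative a1 z) (at z)"
    and a1: "\<And>z. z > 0 \<Longrightarrow> (a1 has_real_derivative a2 z) (at z)"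
    and c: "\<And>z. z > 0 \<Longrightarrow> (c has_real_derivative c1 z) (at z)"
    and c1: "\<And>z. z > 0 \<Longrightarrow> (c1 has_real_derivative c2 z) (at z)"
    and q: "\<And>z. z > 0 \<Longrightarrow> (q has_real_derivative q1 z) (at z)"
    and div: "\<And>z. z > 0 \<Longrightarrow> c1 z = z * a1 z"
    and horizontal: "\<And>z. z > 0 \<Longrightarrow> - ((1 + z\<^sup>2) * a2 z + 3 * z * a1 z)
       + (c z - z * a z) * a1 z - (a z)\<^sup>2 - (2 * q z + z * q1 z) = 0"
    and vertical: "\<And>z. z > 0 \<Longrightarrow> - ((1 + z\<^sup>2) * c2 z + 3 * z * c1 z + c z)
       + (c z - z * a z) * c1 z - a z * c z + q1 z = 0"
    and bc: "c 0 = 0" "a 0 = 0 \<or> a1 0 = 0"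
    and lim: "((\<lambda>z. z\<^sup>2 * a z) \<longlongrightarrow> \<alpha>) at_top" "(c \<longlongrightarrow> 0) at_top"
    and "z > 0"
  shows "a z = 0 \<and> c z = 0"
proof -
  define m where "m = (\<lambda>z. c z - z * a z)"
  define N where "N = (\<lambda>z. - (1 + z\<^sup>2) * a z + z * m z - (m z)\<^sup>2 / 2)"
  define n where "n = (\<lambda>z. q z - 2 * a z)"
  \<comment> \<open>\<open>W\<close> is \<open>1 + z\<^sup>2\<close> times the derivative of
    \<open>n\<close>, with second derivatives eliminated (see \<open>Wn\<close>). It is also the
    derivative of \<open>N\<close> minus \<open>2 * z * n z\<close>, which makes \<open>Q\<close>
    below constant.\<close>
  define W where "W = (\<lambda>z. - (1 + z\<^sup>2) * a1 z - 3 * z * a z + m z + m z * a z - 2 * z * n z)"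
  have pos: "1 + z\<^sup>2 > 0" "1 + z\<^sup>2 \<noteq> 0" "sqrt (1 + z\<^sup>2) > 0" "sqrt (1 + z\<^sup>2) \<noteq> 0" "(sqrt (1 + z\<^sup>2))\<^sup>2 = 1 + z\<^sup>2"
    for z :: real
    using zero_le_power2[of z] by (auto simp: add_nonneg_eq_0_iff intro: add_pos_nonneg)
  have contm: "continuous_on {0..} m"
    unfolding m_def by (intro continuous_intros cont)
  have contN: "continuous_on {0..} N"
    unfolding N_def by (intro continuous_intros cont contm) auto
  have m: "(m has_real_derivative - a z) (at z)" if "z > 0" for z
  proof -
    have "(m has_real_derivative c1 z - (a z + z * a1 z)) (at z)"
      unfolding m_def using a[OF that] c[OF that]
      by (auto intro!: derivative_eq_intros)
    then show ?thesis using div[OF that] by simp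
  qed
  have c2: "c2 z = a1 z + z * a2 z" if "z > 0" for z
  proof (rule DERIV_unique[OF c1[OF that]])
    have "((\<lambda>z. z * a1 z) has_real_derivative a1 z + z * a2 z) (at z)"
      using a1[OF that] by (auto intro!: derivative_eq_intros)
    then show "(c1 has_real_derivative a1 z + z * a2 z) (at z)"
      by (rule has_field_derivative_transform_within_open[of _ _ _ "{0<..}"]) (use that div in auto)
  qed
  have vert: "q1 z = (1 + z\<^sup>2) * (a1 z + z * a2 z) + 3 * z * (z * a1 z) + (m z + z * a z)
      - m z * (z * a1 z) + a z * (m z + z * a z)" if "z > 0" for z
    using vertical[OF that] unfolding c2[OF that] div[OF that] by (simp add: m_def)
  have horiz: "(1 + z\<^sup>2) * a2 z = - 3 * z * a1 z + m z * a1 z - (a z)\<^sup>2 - (2 * q z + z * q1 z)"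
    if "z > 0" for z
    using horizontal[OF that] by (simp add: m_def)

  define Q where "Q = (\<lambda>z. (1 + z\<^sup>2) * n z - N z)"
  have N': "(N has_real_derivative - (1 + z\<^sup>2) * a1 z - 3 * z * a z + m z + m z * a z) (at z)"
    if "z > 0" for z
    unfolding N_def using m[OF that] a[OF that]
    by (auto intro!: derivative_eq_intros simp: field_simps)
  have n': "(n has_real_derivative q1 z - 2 * a1 z) (at z)" if "z > 0" for z
    unfolding n_def using q[OF that] a[OF that] by (auto intro!: derivative_eq_intros)
  \<comment> \<open>Adding \<open>z\<close> times the first momentum equation to the second one
    eliminates \<open>a2\<close>, because (1 + z^2) q1 = z (z q1) + q1.\<close>
  have Wn: "(1 + z\<^sup>2) * (q1 z - 2 * a1 z) = W z" if "z > 0" for z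
  proof -
    have "z * q1 z = - 3 * z * a1 z + m z * a1 z - (a z)\<^sup>2 - 2 * q z - (1 + z\<^sup>2) * a2 z"
      using horiz[OF that] by simp
    then have e: "z * (z * q1 z) = z * (- 3 * z * a1 z + m z * a1 z - (a z)\<^sup>2 - 2 * q z - (1 + z\<^sup>2) * a2 z)"
      by (simp only:)
    have "(1 + z\<^sup>2) * (q1 z - 2 * a1 z) = (z * (z * q1 z) + q1 z) - 2 * (1 + z\<^sup>2) * a1 z"
      by (simp add: algebra_simps power2_eq_square)
    also have "z * (z * q1 z) + q1 z = z * (- 3 * z * a1 z + m z * a1 z - (a z)\<^sup>2 - 2 * q z - (1 + z\<^sup>2) * a2 z)
      + ((1 + z\<^sup>2) * (a1 z + z * a2 z) + 3 * z * (z * a1 z) + (m z + z * a z)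
      - m z * (z * a1 z) + a z * (m z + z * a z))"
      by (rule arg_cong2[where f = "(+)", OF e vert[OF that]])
    finally show ?thesis
      unfolding W_def n_def by (simp add: algebra_simps power2_eq_square)
  qed
  have Q': "(Q has_real_derivative 0) (at z)" if "z > 0" for z
  proof -
    have "(Q has_real_derivative 2 * z * n z + (1 + z\<^sup>2) * (q1 z - 2 * a1 z)
        - (- (1 + z\<^sup>2) * a1 z - 3 * z * a z + m z + m z * a z)) (at z)"
      unfolding Q_def using n'[OF that] N'[OF that] by (auto intro!: derivative_eq_intros)
    then show ?thesis unfolding Wn[OF that] by (simp add: W_def)
  qed
  define C where "C = Q 1"
  have NC: "N z = (1 + z\<^sup>2) * n z - C" if "z > 0" for z
    using constant_of_zero_derivative_pos[OF Q' that] by (simp add: Q_def C_def)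

  \<comment> \<open>In view of \<open>Wn\<close> this is a linear first order equation for
    \<open>W\<close>, with integrating factor \<open>sqrt (1 + z\<^sup>2)\<close>.\<close>
  have W': "(W has_real_derivative - z * (q1 z - 2 * a1 z)) (at z)" if "z > 0" for z
  proof -
    have "(W has_real_derivative - ((1 + z\<^sup>2) * a2 z) - 2 * z * a1 z - 3 * a z - 3 * z * a1 z - a z
        + m z * a1 z - (a z)\<^sup>2 - 2 * n z - 2 * z * (q1 z - 2 * a1 z)) (at z)"
      unfolding W_def using m[OF that] a[OF that] a1[OF that] n'[OF that]
      by (auto intro!: derivative_eq_intros simp: field_simps power2_eq_square)
    moreover have "- ((1 + z\<^sup>2) * a2 z) - 2 * z * a1 z - 3 * a z - 3 * z * a1 z - a z
        + m z * a1 z - (a z)\<^sup>2 - 2 * n z - 2 * z * (q1 z - 2 * a1 z) = - z * (q1 z - 2 * a1 z)"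
      unfolding horiz[OF that] n_def by (simp add: algebra_simps)
    ultimately show ?thesis by (simp only:)
  qed
  have sqrt': "((\<lambda>z. sqrt (1 + z\<^sup>2)) has_real_derivative z / sqrt (1 + z\<^sup>2)) (at z)" for z :: real
    using pos[of z] by (auto intro!: derivative_eq_intros simp: field_simps)
  have sqrt_cancel: "z / sqrt (1 + z\<^sup>2) * ((1 + z\<^sup>2) * X) = z * X * sqrt (1 + z\<^sup>2)" for z X :: real
  proof -
    have "z / s * (s\<^sup>2 * X) = z * X * s" if "s \<noteq> 0" for s :: real
      using that by (simp add: power2_eq_square)
    from this[OF pos(4)[of z]] show ?thesis
      unfolding pos(5) .
  qed
  define K where "K = W 1 * sqrt (1 + 1\<^sup>2)"
  have WK: "W z * sqrt (1 + z\<^sup>2) = K" if "z > 0" for z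
  proof -
    have "((\<lambda>z. W z * sqrt (1 + z\<^sup>2)) has_real_derivative 0) (at z)" if "z > 0" for z
    proof -
      have "((\<lambda>z. W z * sqrt (1 + z\<^sup>2)) has_real_derivative
         - z * (q1 z - 2 * a1 z) * sqrt (1 + z\<^sup>2) + z / sqrt (1 + z\<^sup>2) * W z) (at z)"
        by (rule DERIV_mult[OF W'[OF that] sqrt'])
      moreover have "z / sqrt (1 + z\<^sup>2) * W z = z * (q1 z - 2 * a1 z) * sqrt (1 + z\<^sup>2)"
        unfolding Wn[OF that, symmetric] by (rule sqrt_cancel)
      ultimately show ?thesis by simp
    qed
    from constant_of_zero_derivative_pos[OF this that] show ?thesis
      by (simp add: K_def)
  qed
  define L where "L = n 1 - K * (1 / sqrt (1 + 1\<^sup>2))"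
  \<comment> \<open>By \<open>Wn\<close> and \<open>WK\<close> the derivative of \<open>n\<close> is
    K (1 + z^2)^(-3/2), and z / sqrt (1 + z^2) is a primitive of (1 + z^2)^(-3/2).\<close>
  have nL: "n z = L + K * (z / sqrt (1 + z\<^sup>2))" if "z > 0" for z
  proof -
    have "((\<lambda>z. n z - K * (z / sqrt (1 + z\<^sup>2))) has_real_derivative 0) (at z)" if "z > 0" for z
    proof -
      have "((\<lambda>z. z / sqrt (1 + z\<^sup>2)) has_real_derivative
          (1 * sqrt (1 + z\<^sup>2) - z * (z / sqrt (1 + z\<^sup>2))) / (sqrt (1 + z\<^sup>2) * sqrt (1 + z\<^sup>2))) (at z)"
        by (rule DERIV_divide[OF DERIV_ident sqrt']) (use pos in auto)
      moreover have "(1 * sqrt (1 + z\<^sup>2) - z * (z / sqrt (1 + z\<^sup>2))) / (sqrt (1 + z\<^sup>2) * sqrt (1 + z\<^sup>2))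
        = 1 / ((1 + z\<^sup>2) * sqrt (1 + z\<^sup>2))"
      proof -
        have "1 * sqrt (1 + z\<^sup>2) - z * (z / sqrt (1 + z\<^sup>2)) = ((sqrt (1 + z\<^sup>2))\<^sup>2 - z\<^sup>2) / sqrt (1 + z\<^sup>2)"
          using pos(4)[of z] by (simp add: divide_simps power2_eq_square)
        then show ?thesis unfolding pos by (simp add: mult.commute)
      qed
      ultimately have "((\<lambda>z. z / sqrt (1 + z\<^sup>2)) has_real_derivative
          1 / ((1 + z\<^sup>2) * sqrt (1 + z\<^sup>2))) (at z)" by (simp only:)
      from DERIV_diff[OF n'[OF that] DERIV_cmult[OF this, of K]]
      have "((\<lambda>z. n z - K * (z / sqrt (1 + z\<^sup>2))) has_real_derivative
          q1 z - 2 * a1 z - K * (1 / ((1 + z\<^sup>2) * sqrt (1 + z\<^sup>2)))) (at z)" .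
      moreover have "q1 z - 2 * a1 z - K * (1 / ((1 + z\<^sup>2) * sqrt (1 + z\<^sup>2))) = 0"
        unfolding WK[OF that, symmetric] Wn[OF that, symmetric] using pos[of z] by simp
      ultimately show ?thesis by (simp only:)
    qed
    from constant_of_zero_derivative_pos[OF this that] show ?thesis
      by (simp add: L_def)
  qed
  have N: "N z = (1 + z\<^sup>2) * L + K * z * sqrt (1 + z\<^sup>2) - C" if "z > 0" for z
  proof -
    have "(1 + z\<^sup>2) * (K * (z / sqrt (1 + z\<^sup>2))) = K * z * sqrt (1 + z\<^sup>2)"
      using sqrt_cancel[of z K] by (simp only: ac_simps)
    then show ?thesis
      unfolding NC[OF that] nL[OF that] by (simp add: distrib_left)
  qed

  have inv: "((\<lambda>z::real. 1 / z) \<longlongrightarrow> 0) at_top"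
    by real_asymp
  have "((\<lambda>z. 1 / z * (z\<^sup>2 * a z)) \<longlongrightarrow> 0 * \<alpha>) at_top"
    by (intro tendsto_mult inv lim)
  moreover have "eventually (\<lambda>z. 1 / z * (z\<^sup>2 * a z) = z * a z) at_top"
    using eventually_gt_at_top[of 0] by eventually_elim (simp add: power2_eq_square)
  ultimately have za: "((\<lambda>z. z * a z) \<longlongrightarrow> 0) at_top"
    by (simp add: tendsto_cong)
  have m_lim: "(m \<longlongrightarrow> 0) at_top"
    using tendsto_diff[OF lim(2) za] by (simp add: m_def)
  have a_lim: "(a \<longlongrightarrow> 0) at_top"
  proof -
    have "((\<lambda>z. 1 / z * (z * a z)) \<longlongrightarrow> 0 * 0) at_top"
      by (intro tendsto_mult inv za)
    moreover have "eventually (\<lambda>z. 1 / z * (z * a z) = a z) at_top"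
      using eventually_gt_at_top[of 0] by eventually_elim simp
    ultimately show ?thesis by (simp add: tendsto_cong)
  qed
  \<comment> \<open>The terms \<open>z\<^sup>2 * a z\<close> and \<open>z * m z\<close> have the
    same limit \<alpha> and enter with opposite signs.\<close>
  have "((\<lambda>z. - a z - z\<^sup>2 * a z + z * m z - (m z)\<^sup>2 / 2) \<longlongrightarrow> - 0 - \<alpha> + \<alpha> - 0\<^sup>2 / 2) at_top"
    by (intro tendsto_intros a_lim m_lim lim tendsto_times_of_derivative_asymp[OF m]) auto
  then have "(N \<longlongrightarrow> 0) at_top"
    by (simp add: N_def algebra_simps)
  then have N_lim: "((\<lambda>z. (1 + z\<^sup>2) * L + K * z * sqrt (1 + z\<^sup>2) - C) \<longlongrightarrow> 0) at_top"
    by (rule Lim_transform_eventually)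
      (rule eventually_mono[OF eventually_gt_at_top[of 0] N])
  \<comment> \<open>Dividing by \<open>z\<^sup>2\<close> isolates the coefficient of quadratic
    growth, which is \<open>L + K\<close>.\<close>
  have "((\<lambda>z. 1 / z\<^sup>2 * ((1 + z\<^sup>2) * L + K * z * sqrt (1 + z\<^sup>2) - C)) \<longlongrightarrow> 0 * 0) at_top"
    by (rule tendsto_mult[OF _ N_lim]) real_asymp
  moreover have "((\<lambda>z. 1 / z\<^sup>2 * ((1 + z\<^sup>2) * L + K * z * sqrt (1 + z\<^sup>2) - C)) \<longlongrightarrow> L + K) at_top"
  proof -
    have *: "((\<lambda>z::real. 1 / z\<^sup>2 * (1 + z\<^sup>2)) \<longlongrightarrow> 1) at_top"
      "((\<lambda>z::real. 1 / z\<^sup>2 * z * sqrt (1 + z\<^sup>2)) \<longlongrightarrow> 1) at_top"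
      "((\<lambda>z::real. 1 / z\<^sup>2) \<longlongrightarrow> 0) at_top"
      by (real_asymp, real_asymp, real_asymp)
    have "((\<lambda>z. (1 / z\<^sup>2 * (1 + z\<^sup>2)) * L + K * (1 / z\<^sup>2 * z * sqrt (1 + z\<^sup>2)) - 1 / z\<^sup>2 * C)
       \<longlongrightarrow> 1 * L + K * 1 - 0 * C) at_top"
      by (intro tendsto_intros *)
    moreover have "1 / z\<^sup>2 * ((1 + z\<^sup>2) * L + K * z * sqrt (1 + z\<^sup>2) - C)
        = (1 / z\<^sup>2 * (1 + z\<^sup>2)) * L + K * (1 / z\<^sup>2 * z * sqrt (1 + z\<^sup>2)) - 1 / z\<^sup>2 * C" for z
      by (simp only: distrib_left distrib_right right_diff_distrib ac_simps)
    ultimately show ?thesis by simp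
  qed
  ultimately have "L + K = 0"
    using tendsto_unique[OF trivial_limit_at_top_linorder] by fastforce
  then have KL: "K = - L" by simp
  \<comment> \<open>With \<open>K = - L\<close> the growing parts cancel, and the remaining limit L
    / 2 - C must be 0.\<close>
  have "((\<lambda>z. L * (1 + z\<^sup>2 - z * sqrt (1 + z\<^sup>2)) - C) \<longlongrightarrow> L * (1 / 2) - C) at_top"
  proof -
    have *: "((\<lambda>z::real. 1 + z\<^sup>2 - z * sqrt (1 + z\<^sup>2)) \<longlongrightarrow> 1 / 2) at_top"
      by real_asymp
    show ?thesis by (intro tendsto_intros *)
  qed
  moreover have "((\<lambda>z. L * (1 + z\<^sup>2 - z * sqrt (1 + z\<^sup>2)) - C) \<longlongrightarrow> 0) at_top"
    using N_lim by (simp add: KL algebra_simps)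
  ultimately have "L * (1 / 2) - C = 0"
    using tendsto_unique[OF trivial_limit_at_top_linorder] by blast
  then have CL: "C = L / 2" by simp

  have at0: "(f \<longlongrightarrow> f 0) (at_right 0)" if "continuous_on {0..} f" for f :: "real \<Rightarrow> real"
    using continuous_on_Icc_at_rightD[of 0 1 f] continuous_on_subset[OF that, of "{0..1}"] by auto
  have pos0: "eventually (\<lambda>z::real. z > 0) (at_right 0)"
    by (simp add: eventually_at_right_less)
  have m0: "m 0 = 0" using bc by (simp add: m_def)
  have L0: "L = 0"
    using bc(2)
  proof
    assume "a 0 = 0"
    then have "N 0 = 0" by (simp add: N_def m0)
    \<comment> \<open>The formula for \<open>N\<close> is known for positive \<open>z\<close> only,
      so its value at 0 is taken as a right limit.\<close>
    moreover have "((\<lambda>z. (1 + z\<^sup>2) * L + K * z * sqrt (1 + z\<^sup>2) - C) \<longlongrightarrow> (1 + 0\<^sup>2) * L + K * 0 * sqrt (1 + 0\<^sup>2) - C) (at_right 0)"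
      by (intro tendsto_intros)
    moreover have "((\<lambda>z. (1 + z\<^sup>2) * L + K * z * sqrt (1 + z\<^sup>2) - C) \<longlongrightarrow> N 0) (at_right 0)"
      by (rule Lim_transform_eventually[OF at0[OF contN]])
        (rule eventually_mono[OF pos0 N])
    ultimately have "L - C = 0"
      using tendsto_unique[of "at_right (0::real)"] by fastforce
    then show ?thesis by (simp add: CL)
  next
    assume "a1 0 = 0"
    \<comment> \<open>Continuity of \<open>q\<close>, and hence of \<open>n\<close>, at 0 is not
      among the hypotheses; the explicit formula replaces \<open>n\<close> before the limit is
      taken.\<close>
    define n0 where "n0 = (\<lambda>z. L + K * (z / sqrt (1 + z\<^sup>2)))"
    have "((\<lambda>z. (- (1 + z\<^sup>2) * a1 z - 3 * z * a z + m z + m z * a z - 2 * z * n0 z) * sqrt (1 + z\<^sup>2))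
      \<longlongrightarrow> (- (1 + 0\<^sup>2) * a1 0 - 3 * 0 * a 0 + m 0 + m 0 * a 0 - 2 * 0 * (L + K * (0 / sqrt (1 + 0\<^sup>2)))) * sqrt (1 + 0\<^sup>2)) (at_right 0)"
      unfolding n0_def by (intro tendsto_intros at0 cont contm) auto
    moreover have "eventually (\<lambda>z. (- (1 + z\<^sup>2) * a1 z - 3 * z * a z + m z + m z * a z - 2 * z * n0 z) * sqrt (1 + z\<^sup>2) = K) (at_right 0)"
      using pos0 by eventually_elim (use WK nL in \<open>simp add: W_def n0_def\<close>)
    ultimately have "((\<lambda>z::real. K) \<longlongrightarrow> 0) (at_right 0)"
      by (simp add: \<open>a1 0 = 0\<close> m0 tendsto_cong)
    then show ?thesis by (simp add: KL tendsto_const_iff)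
  qed
  have N0: "N z = 0" if "z > 0" for z
    using N[OF that] L0 KL CL by simp
  \<comment> \<open>The Riccati equation \<open>N = 0\<close> is read as a linear one whose
    continuous coefficient contains \<open>m\<close> itself, so that \<open>linear_ode_zero\<close>
    applies.\<close>
  have "(m has_real_derivative ((m z / 2 - z) / (1 + z\<^sup>2)) * m z) (at z)" if "z > 0" for z
  proof -
    have "(1 + z\<^sup>2) * a z = z * m z - (m z)\<^sup>2 / 2"
      using N0[OF that] by (simp add: N_def algebra_simps)
    then have "- a z = (m z / 2 - z) / (1 + z\<^sup>2) * m z"
      using pos[of z] by (simp add: field_simps power2_eq_square)
    then show ?thesis using m[OF that] by simp
  qed
  note zero = linear_ode_zero[OF contm _ this order.refl m0]
  have m_zero: "m z = 0" if "z > 0" for z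
    by (rule zero) (use that pos in \<open>auto intro!: continuous_intros contm\<close>)
  have "a z = 0"
    using N0[OF \<open>z > 0\<close>] pos[of z] by (simp add: N_def m_zero[OF \<open>z > 0\<close>])
  then show ?thesis
    using m_zero[OF \<open>z > 0\<close>] by (simp add: m_def)
qed

section \<open>Homogeneous and axisymmetric fields\<close>

lemma open_half_space: "open half_space"
  unfolding half_space_def by (rule open_halfspace_component_gt_cart)

lemma half_space_subset_closed: "half_space \<subseteq> half_space_closed"
  by (simp add: half_space_closed_def)

lemma at_within_half_space:
  "half_space \<subseteq> S \<Longrightarrow> x \<in> half_space \<Longrightarrow> at x within S = at x"
  by (rule at_within_open_subset[OF _ open_half_space])

lemma smooth_on_partial: "smooth_on S f \<Longrightarrow> smooth_on S (partial S i f)"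
  unfolding smooth_on_def
proof
  fix k
  assume "\<forall>k. C_k_on k S f"
  then have "C_k_on (Suc k) S f" ..
  then show "C_k_on k S (partial S i f)" by simp
qed

lemma smooth_on_differentiable: "smooth_on S f \<Longrightarrow> x \<in> S \<Longrightarrow> f differentiable (at x within S)"
  unfolding smooth_on_def by (auto dest: spec[of _ "Suc 0"] simp: differentiable_on_def)

lemma smooth_on_continuous: "smooth_on S f \<Longrightarrow> continuous_on S f"
  unfolding smooth_on_def by (auto dest: spec[of _ 0])

text \<open>\<open>frechet_derivative\<close> chooses from the predicate
  \<open>has_derivative\<close>, and this predicate is the same for \<open>f\<close> and
  \<open>g\<close>; the argument therefore covers points without differentiability.\<close>

lemma partial_cong:
  assumes "\<And>y. y \<in> S \<Longrightarrow> f y = g y" "x \<in> S"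
  shows "partial S i f x = partial S i g x"
proof -
  have "(f has_derivative D) (at x within S) \<longleftrightarrow> (g has_derivative D) (at x within S)" for D
    using has_derivative_transform[OF assms(2)] assms(1) by metis
  then show ?thesis
    by (simp add: partial_def frechet_derivative_def)
qed

lemma partial_half_space_eq:
  assumes "half_space \<subseteq> S" "x \<in> half_space"
  shows "partial S i f x = partial half_space i f x"
  unfolding partial_def
  using at_within_half_space[OF assms] at_within_half_space[OF order.refl assms(2)] by simp

text \<open>The inner partials agree on the whole open half space, not just at \<open>x\<close>, so
  their derivatives agree too. This moves the equations to derivatives within the closed half
  space.\<close>

lemma partial_partial_half_space_eq:
  assumes "half_space \<subseteq> S" "x \<in> half_space"
  shows "partial S i (partial S j f) x = partial half_space i (partial half_space j f) x"
  by (simp add: partial_half_space_eq[OF assms] partial_cong[OF partial_half_space_eq[OF assms(1)] assms(2)])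

text \<open>The chain rule in terms of partials. The curves used later are rays, coordinate lines,
  circles and \<open>cyl_line\<close>; the parameter set \<open>T\<close> permits a curve that
  starts on the boundary.\<close>

lemma has_vector_derivative_along_curve:
  assumes "f differentiable (at (\<gamma> t) within S)"
    and "(\<gamma> has_vector_derivative v) (at t within T)" "\<gamma> ` T \<subseteq> S"
  shows "((\<lambda>t. f (\<gamma> t)) has_vector_derivative
     v $ 1 *\<^sub>R partial S 1 f (\<gamma> t) + v $ 2 *\<^sub>R partial S 2 f (\<gamma> t) + v $ 3 *\<^sub>R partial S 3 f (\<gamma> t))
     (at t within T)"
proof -
  let ?D = "frechet_derivative f (at (\<gamma> t) within S)"
  have D: "(f has_derivative ?D) (at (\<gamma> t) within S)"
    using assms(1) by (simp add: frechet_derivative_works)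
  have "linear ?D"
    using D has_derivative_linear by blast
  have "?D v = ?D (\<Sum>i\<in>UNIV. v $ i *\<^sub>R axis i 1)"
    using basis_expansion[of v] by (simp add: scalar_mult_eq_scaleR)
  also have "\<dots> = v $ 1 *\<^sub>R partial S 1 f (\<gamma> t) + v $ 2 *\<^sub>R partial S 2 f (\<gamma> t) + v $ 3 *\<^sub>R partial S 3 f (\<gamma> t)"
    using \<open>linear ?D\<close> by (simp add: sum_3 linear_add linear_scale partial_def)
  finally show ?thesis
    using vector_derivative_diff_chain_within[OF assms(2) has_derivative_subset[OF D assms(3)]]
    by (simp add: o_def)
qed

lemma has_vector_derivative_vector_3:
  assumes "(f has_real_derivative f') F" "(g has_real_derivative g') F" "(h has_real_derivative h') F"
  shows "((\<lambda>t. vector [f t, g t, h t] :: real^3) has_vector_derivative vector [f', g', h']) F"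
proof -
  have eq: "(vector [a, b, c] :: real^3) = a *\<^sub>R axis 1 1 + b *\<^sub>R axis 2 1 + c *\<^sub>R axis 3 1" for a b c
    by (simp add: vec_eq_iff forall_3 axis_def)
  show ?thesis
    unfolding eq using assms unfolding has_real_derivative_iff_has_vector_derivative
    by (intro has_vector_derivative_add bounded_linear.has_vector_derivative[OF bounded_linear_scaleR_left])
qed

lemma has_real_derivative_component:
  "(f has_vector_derivative f') F \<Longrightarrow> ((\<lambda>t. f t $ i) has_real_derivative f' $ i) F" for f :: "real \<Rightarrow> real^3"
  unfolding has_real_derivative_iff_has_vector_derivative
  by (rule bounded_linear.has_vector_derivative[OF bounded_linear_vec_nth])

section \<open>Homogeneous functions\<close>

lemma scaleR_half_space: "x \<in> half_space \<Longrightarrow> \<mu> > 0 \<Longrightarrow> \<mu> *\<^sub>R x \<in> half_space"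
  by (simp add: half_space_def)


text \<open>Both sides are the derivative of \<open>f (\<mu> *\<^sub>R x)\<close> at
  \<open>\<mu> = 1\<close>, once by the chain rule and once by homogeneity. The convention in
  \<open>hom\<close> means degree \<open>- n\<close>, hence the minus sign.\<close>

lemma euler_homogeneous:
  fixes f :: "real^3 \<Rightarrow> 'b::real_normed_vector"
  assumes S: "half_space \<subseteq> S" and diff: "f differentiable (at x within S)" and x: "x \<in> half_space"
    and hom: "\<And>\<mu> x. \<mu> > 0 \<Longrightarrow> x \<in> half_space \<Longrightarrow> f x = \<mu> ^ n *\<^sub>R f (\<mu> *\<^sub>R x)"
  shows "x $ 1 *\<^sub>R partial S 1 f x + x $ 2 *\<^sub>R partial S 2 f x + x $ 3 *\<^sub>R partial S 3 f x = - (real n *\<^sub>R f x)"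
proof -
  have "((\<lambda>\<mu>. \<mu> *\<^sub>R x) has_vector_derivative x) (at 1 within {0<..})"
    by (auto intro!: derivative_eq_intros)
  from has_vector_derivative_along_curve[OF _ this, of f S] diff x S
  have "((\<lambda>\<mu>. f (\<mu> *\<^sub>R x)) has_vector_derivative
      x $ 1 *\<^sub>R partial S 1 f x + x $ 2 *\<^sub>R partial S 2 f x + x $ 3 *\<^sub>R partial S 3 f x) (at 1 within {0<..})"
    using scaleR_half_space by auto
  then have 1: "((\<lambda>\<mu>. f (\<mu> *\<^sub>R x)) has_vector_derivative
      x $ 1 *\<^sub>R partial S 1 f x + x $ 2 *\<^sub>R partial S 2 f x + x $ 3 *\<^sub>R partial S 3 f x) (at 1)"
    by (simp add: at_within_open[of 1 "{0<..}"])
  have "((\<lambda>\<mu>::real. inverse (\<mu> ^ n)) has_real_derivative - real n) (at 1)"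
    by (auto intro!: derivative_eq_intros)
  from has_vector_derivative_scaleR[OF this has_vector_derivative_const[of "f x"]]
  have "((\<lambda>\<mu>::real. inverse (\<mu> ^ n) *\<^sub>R f x) has_vector_derivative - (real n *\<^sub>R f x)) (at 1)"
    by simp
  then have "((\<lambda>\<mu>. f (\<mu> *\<^sub>R x)) has_vector_derivative - (real n *\<^sub>R f x)) (at 1)"
  proof (rule has_vector_derivative_transform_within_open[of _ _ _ "{0<..}"])
    show "inverse (\<mu> ^ n) *\<^sub>R f x = f (\<mu> *\<^sub>R x)" if "\<mu> \<in> {0<..}" for \<mu>
      using hom[of \<mu> x] that x by simp
  qed auto
  from vector_derivative_unique_at[OF 1 this] show ?thesis .
qed

lemma has_vector_derivative_partial:
  fixes f :: "real^3 \<Rightarrow> 'b::real_normed_vector"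
  assumes S: "half_space \<subseteq> S" and diff: "f differentiable (at x within S)" and x: "x \<in> half_space"
  shows "((\<lambda>t. f (x + t *\<^sub>R axis i 1)) has_vector_derivative partial S i f x) (at 0)"
proof -
  \<comment> \<open>An open set of parameters for which the line stays in the half space, so that a
    derivative within it is an ordinary one.\<close>
  define T where "T = {t. x + t *\<^sub>R axis i 1 \<in> half_space}"
  have "open T"
    unfolding T_def using open_half_space
    by (intro open_vimage[unfolded vimage_def]) (auto intro!: continuous_intros)
  have "0 \<in> T" using x by (simp add: T_def)
  have "((\<lambda>t::real. x + t *\<^sub>R axis i 1) has_vector_derivative axis i 1) (at 0 within T)"
    by (auto intro!: derivative_eq_intros)
  from has_vector_derivative_along_curve[OF _ this, of f S] diff S
  have "((\<lambda>t. f (x + t *\<^sub>R axis i 1)) has_vector_derivative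
      (axis i 1 :: real^3) $ 1 *\<^sub>R partial S 1 f x + (axis i 1 :: real^3) $ 2 *\<^sub>R partial S 2 f x
      + (axis i 1 :: real^3) $ 3 *\<^sub>R partial S 3 f x) (at 0 within T)"
    by (auto simp: T_def)
  moreover have "(axis i 1 :: real^3) $ 1 *\<^sub>R partial S 1 f x + (axis i 1 :: real^3) $ 2 *\<^sub>R partial S 2 f x
      + (axis i 1 :: real^3) $ 3 *\<^sub>R partial S 3 f x = partial S i f x"
    using exhaust_3[of i] by (auto simp: axis_def)
  ultimately show ?thesis
    using at_within_open[OF \<open>0 \<in> T\<close> \<open>open T\<close>] by simp
qed

text \<open>A step \<open>t\<close> from \<open>x\<close> becomes a step \<open>\<mu> * t\<close>
  from the scaled point, and this inner factor raises the exponent by one.\<close>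

lemma homogeneous_partial:
  fixes f :: "real^3 \<Rightarrow> 'b::real_normed_vector"
  assumes S: "half_space \<subseteq> S" and diff: "\<And>x. x \<in> half_space \<Longrightarrow> f differentiable (at x within S)"
    and hom: "\<And>\<mu> x. \<mu> > 0 \<Longrightarrow> x \<in> half_space \<Longrightarrow> f x = \<mu> ^ n *\<^sub>R f (\<mu> *\<^sub>R x)"
    and \<mu>: "\<mu> > 0" and x: "x \<in> half_space"
  shows "partial S i f x = \<mu> ^ Suc n *\<^sub>R partial S i f (\<mu> *\<^sub>R x)"
proof -
  have 1: "((\<lambda>t. f (x + t *\<^sub>R axis i 1)) has_vector_derivative partial S i f x) (at 0)"
    by (rule has_vector_derivative_partial[OF S diff[OF x] x])
  have \<mu>x: "\<mu> *\<^sub>R x \<in> half_space" by (rule scaleR_half_space[OF x \<mu>])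
  have "((\<lambda>t. \<mu> * t) has_real_derivative \<mu>) (at 0)"
    by (auto intro!: derivative_eq_intros)
  moreover have "((\<lambda>t. f (\<mu> *\<^sub>R x + t *\<^sub>R axis i 1)) has_vector_derivative partial S i f (\<mu> *\<^sub>R x)) (at (\<mu> * 0))"
    using has_vector_derivative_partial[OF S diff[OF \<mu>x] \<mu>x] by simp
  ultimately have "((\<lambda>t. f (\<mu> *\<^sub>R x + (\<mu> * t) *\<^sub>R axis i 1)) has_vector_derivative \<mu> *\<^sub>R partial S i f (\<mu> *\<^sub>R x)) (at 0)"
    using vector_diff_chain_at[of "\<lambda>t. \<mu> * t" \<mu> 0] 
    by (simp add: o_def has_real_derivative_iff_has_vector_derivative)
  from bounded_linear.has_vector_derivative[OF bounded_linear_scaleR_right this, of "\<mu> ^ n"]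
  have 2: "((\<lambda>t. \<mu> ^ n *\<^sub>R f (\<mu> *\<^sub>R (x + t *\<^sub>R axis i 1))) has_vector_derivative
      \<mu> ^ Suc n *\<^sub>R partial S i f (\<mu> *\<^sub>R x)) (at 0)"
    by (simp add: scaleR_add_right mult.commute)
  define T where "T = {t. x + t *\<^sub>R axis i 1 \<in> half_space}"
  have "open T"
    unfolding T_def using open_half_space
    by (intro open_vimage[unfolded vimage_def]) (auto intro!: continuous_intros)
  have "((\<lambda>t. f (x + t *\<^sub>R axis i 1)) has_vector_derivative
      \<mu> ^ Suc n *\<^sub>R partial S i f (\<mu> *\<^sub>R x)) (at 0)"
    by (rule has_vector_derivative_transform_within_open[OF 2 \<open>open T\<close>])
      (use x \<mu> hom in \<open>auto simp: T_def\<close>)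
  from vector_derivative_unique_at[OF 1 this] show ?thesis .
qed

text \<open>The generator of rotations about the axis, that is, the cross product of
  \<open>e_z\<close> with \<open>v\<close>. Unlike a quarter turn it kills the vertical
  component.\<close>

definition rot90 :: "real^3 \<Rightarrow> real^3" where
  "rot90 v = vector [- v $ 2, v $ 1, 0]"

lemma rot90_nth [simp]: "rot90 v $ 1 = - v $ 2" "rot90 v $ 2 = v $ 1" "rot90 v $ 3 = 0"
  by (simp_all add: rot90_def)

lemma bounded_linear_rot90: "bounded_linear rot90"
  unfolding linear_conv_bounded_linear[symmetric]
  by (rule linearI) (simp_all add: vec_eq_iff forall_3)

lemma cyl_point_in_half_space: "z > 0 \<Longrightarrow> cyl_point r \<theta> z \<in> half_space"
  by (simp add: cyl_point_def half_space_def)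

lemma cylindrical_coordinates:
  assumes "x $ 1 \<noteq> 0 \<or> x $ 2 \<noteq> 0"
  obtains r \<theta> where "r > 0" "x = cyl_point r \<theta> (x $ 3)"
proof -
  define r where "r = sqrt ((x $ 1)\<^sup>2 + (x $ 2)\<^sup>2)"
  have r: "r > 0" using assms by (auto simp: r_def sum_power2_gt_zero_iff)
  have "r\<^sup>2 = (x $ 1)\<^sup>2 + (x $ 2)\<^sup>2" by (simp add: r_def)
  then have "((x $ 1)\<^sup>2 + (x $ 2)\<^sup>2) / r\<^sup>2 = 1"
    using r by (metis divide_self less_irrefl power_not_zero)
  then have "(x $ 1 / r)\<^sup>2 + (x $ 2 / r)\<^sup>2 = 1"
    by (simp only: power_divide add_divide_distrib)
  then obtain \<theta> where "x $ 1 / r = cos \<theta>" "x $ 2 / r = sin \<theta>"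
    using sincos_total_2pi by metis
  then have "x $ 1 = r * cos \<theta>" "x $ 2 = r * sin \<theta>"
    using r by (auto simp: field_simps)
  then have "x = cyl_point r \<theta> (x $ 3)"
    by (simp add: cyl_point_def vec_eq_iff forall_3)
  with r that show ?thesis by blast
qed

lemma axisymmetric_cyl_point:
  assumes "axisymmetric_with w wr wt wz" "r > 0" "z > 0"
  shows "w (cyl_point r \<theta> z) =
      vector [wr r z * cos \<theta> - wt r z * sin \<theta>, wr r z * sin \<theta> + wt r z * cos \<theta>, wz r z]"
  using assms unfolding axisymmetric_with_def
  by (simp add: e_r_def e_theta_def e_z_def vec_eq_iff forall_3)

text \<open>On a horizontal circle the components in the rotating frame are constant, so the angular
  derivative of \<open>w\<close> is \<open>rot90 (w x)\<close>; the chain rule writes the same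
  derivative through the partials. General \<open>x\<close> is kept so that the identity can be
  differentiated once more.\<close>

lemma axisymmetric_rotation:
  assumes w: "axisymmetric_with w wr wt wz" and S: "half_space \<subseteq> S"
    and diff: "w differentiable (at x within S)" and x: "x \<in> half_space" "x $ 1 \<noteq> 0 \<or> x $ 2 \<noteq> 0"
  shows "x $ 1 *\<^sub>R partial S 2 w x = rot90 (w x) + x $ 2 *\<^sub>R partial S 1 w x"
proof -
  obtain r \<theta> where r: "r > 0" and x_eq: "x = cyl_point r \<theta> (x $ 3)"
    using cylindrical_coordinates[OF x(2)] .
  define z where "z = x $ 3"
  have z: "z > 0" using x by (simp add: z_def half_space_def)
  have xc: "x = cyl_point r \<theta> z" using x_eq by (simp add: z_def)
  have "((\<lambda>\<theta>. cyl_point r \<theta> z) has_vector_derivative vector [- r * sin \<theta>, r * cos \<theta>, 0]) (at \<theta>)"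
    unfolding cyl_point_def
    by (rule has_vector_derivative_vector_3) (auto intro!: derivative_eq_intros)
  from has_vector_derivative_along_curve[OF _ this, of w S] diff cyl_point_in_half_space[OF z] S
  have "((\<lambda>\<theta>. w (cyl_point r \<theta> z)) has_vector_derivative
      (- r * sin \<theta>) *\<^sub>R partial S 1 w x + (r * cos \<theta>) *\<^sub>R partial S 2 w x) (at \<theta>)"
    by (auto simp: xc)
  then have 1: "((\<lambda>\<theta>. w (cyl_point r \<theta> z)) has_vector_derivative
      x $ 1 *\<^sub>R partial S 2 w x - x $ 2 *\<^sub>R partial S 1 w x) (at \<theta>)"
    by (simp add: xc cyl_point_def)
  note w_eq = axisymmetric_cyl_point[OF w r z]
  have "((\<lambda>\<theta>. w (cyl_point r \<theta> z)) has_vector_derivative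
      vector [- wr r z * sin \<theta> - wt r z * cos \<theta>, wr r z * cos \<theta> - wt r z * sin \<theta>, 0]) (at \<theta>)"
    unfolding w_eq
    by (rule has_vector_derivative_vector_3) (auto intro!: derivative_eq_intros)
  moreover have "vector [- wr r z * sin \<theta> - wt r z * cos \<theta>, wr r z * cos \<theta> - wt r z * sin \<theta>, 0] = rot90 (w x)"
    unfolding xc w_eq by (simp add: vec_eq_iff forall_3)
  ultimately have "x $ 1 *\<^sub>R partial S 2 w x - x $ 2 *\<^sub>R partial S 1 w x = rot90 (w x)"
    using vector_derivative_unique_at[OF 1] by simp
  then show ?thesis by (simp add: algebra_simps)
qed

section \<open>Restriction to the points (1, 0, z)\<close>

definition cyl_line :: "real \<Rightarrow> real^3" where
  "cyl_line z = vector [1, 0, z]"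

lemma cyl_line_nth [simp]: "cyl_line z $ 1 = 1" "cyl_line z $ 2 = 0" "cyl_line z $ 3 = z"
  by (simp_all add: cyl_line_def)

lemma cyl_line_half_space: "z > 0 \<Longrightarrow> cyl_line z \<in> half_space"
  by (simp add: half_space_def)

lemma cyl_line_half_space_closed: "z \<ge> 0 \<Longrightarrow> cyl_line z \<in> half_space_closed"
  by (auto simp: half_space_closed_def half_space_def half_space_boundary_def vec_eq_iff forall_3)

lemma cyl_line_derivative_within:
  assumes "smooth_on half_space_closed f" "z \<ge> 0"
  shows "((\<lambda>z. f (cyl_line z)) has_vector_derivative partial half_space_closed 3 f (cyl_line z)) (at z within {0..})"
proof -
  have "(cyl_line has_vector_derivative vector [0, 0, 1]) (at z within {0..})"
    unfolding cyl_line_def[abs_def]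
    by (rule has_vector_derivative_vector_3) (auto intro!: derivative_eq_intros)
  from has_vector_derivative_along_curve[OF _ this, of f half_space_closed]
  show ?thesis
    using smooth_on_differentiable[OF assms(1)] cyl_line_half_space_closed assms(2) by auto
qed

lemma cyl_line_derivative:
  assumes "smooth_on S f" "half_space \<subseteq> S" "z > 0"
  shows "((\<lambda>z. f (cyl_line z)) has_vector_derivative partial S 3 f (cyl_line z)) (at z)"
proof -
  have "(cyl_line has_vector_derivative vector [0, 0, 1]) (at z within {0<..})"
    unfolding cyl_line_def[abs_def]
    by (rule has_vector_derivative_vector_3) (auto intro!: derivative_eq_intros)
  from has_vector_derivative_along_curve[OF _ this, of f S]
  have "((\<lambda>z. f (cyl_line z)) has_vector_derivative partial S 3 f (cyl_line z)) (at z within {0<..})"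
    using smooth_on_differentiable[OF assms(1)] cyl_line_half_space assms by auto
  then show ?thesis
    using at_within_open[of z "{0<..}"] assms(3) by simp
qed

lemma cyl_line_continuous:
  assumes "smooth_on half_space_closed f"
  shows "continuous_on {0..} (\<lambda>z. f (cyl_line z))"
  unfolding continuous_on_eq_continuous_within
  using has_vector_derivative_continuous[OF cyl_line_derivative_within[OF assms]] by simp

text \<open>Euler's identity removes derivatives in the first direction and rotation removes those
  in the second, so that only derivatives along the line remain.\<close>

lemma axisymmetric_homogeneous_partials:
  fixes w :: "real^3 \<Rightarrow> real^3"
  assumes w: "axisymmetric_with w wr wt wz" and smooth: "smooth_on S w" and S: "half_space \<subseteq> S"
    and hom: "\<And>\<mu> x. \<mu> > 0 \<Longrightarrow> x \<in> half_space \<Longrightarrow> w x = \<mu> *\<^sub>R w (\<mu> *\<^sub>R x)"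
    and z: "z > 0"
  defines "x \<equiv> cyl_line z" and "w3 \<equiv> partial S 3 w" and "w33 \<equiv> partial S 3 (partial S 3 w)"
  shows "partial S 1 w x = - w x - z *\<^sub>R w3 x"
    and "partial S 2 w x = rot90 (w x)"
    and "partial S 1 (partial S 1 w) x = 2 *\<^sub>R w x + (4 * z) *\<^sub>R w3 x + z\<^sup>2 *\<^sub>R w33 x"
    and "partial S 2 (partial S 2 w) x = rot90 (rot90 (w x)) - w x - z *\<^sub>R w3 x"
proof -
  have x: "x \<in> half_space" using z by (simp add: x_def cyl_line_half_space)
  note smooth' = smooth_on_partial[OF smooth]
  have diff: "f differentiable (at y within S)" if "smooth_on S f" "y \<in> half_space" for f :: "real^3 \<Rightarrow> real^3" and y
    using smooth_on_differentiable[OF that(1)] that(2) S by blast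
  have p1: "partial S 1 w (cyl_line z) = - w (cyl_line z) - z *\<^sub>R w3 (cyl_line z)" if "z > 0" for z
    using euler_homogeneous[OF S diff[OF smooth cyl_line_half_space[OF that]] cyl_line_half_space[OF that], of 1] hom
    by (simp add: w3_def algebra_simps eq_neg_iff_add_eq_0)
  then show p1x: "partial S 1 w x = - w x - z *\<^sub>R w3 x"
    using z by (simp add: x_def)
  show p2: "partial S 2 w x = rot90 (w x)"
    using axisymmetric_rotation[OF w S diff[OF smooth x] x] by (simp add: x_def)

  \<comment> \<open>The formula \<open>p1\<close> holds along the whole line, so differentiating it
    there gives \<open>p31\<close>. Euler's identity for the first partial, which has degree -2,
    then yields its derivative in the first direction.\<close>
  have "((\<lambda>z. - w (cyl_line z) - z *\<^sub>R w3 (cyl_line z)) has_vector_derivative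
      - w3 x - (w3 x + z *\<^sub>R w33 x)) (at z)"
    unfolding x_def w3_def w33_def
    using cyl_line_derivative[OF smooth S z] cyl_line_derivative[OF smooth' S z]
    by (auto intro!: derivative_eq_intros)
  then have "((\<lambda>z. partial S 1 w (cyl_line z)) has_vector_derivative
      - w3 x - (w3 x + z *\<^sub>R w33 x)) (at z)"
    by (rule has_vector_derivative_transform_within_open[of _ _ _ "{0<..}"]) (use z p1 in auto)
  from vector_derivative_unique_at[OF cyl_line_derivative[OF smooth' S z] this]
  have p31: "partial S 3 (partial S 1 w) x = - w3 x - (w3 x + z *\<^sub>R w33 x)"
    by (simp add: x_def)
  have hom1: "partial S 1 w x = \<mu> ^ Suc 1 *\<^sub>R partial S 1 w (\<mu> *\<^sub>R x)" if "\<mu> > 0" "x \<in> half_space" for \<mu> x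
    by (rule homogeneous_partial[OF S _ _ that]) (use diff smooth hom in auto)
  have "partial S 1 (partial S 1 w) x + z *\<^sub>R partial S 3 (partial S 1 w) x = - (2 *\<^sub>R partial S 1 w x)"
    using euler_homogeneous[OF S diff[OF smooth' x] x hom1] by (simp add: x_def)
  then have "partial S 1 (partial S 1 w) x = - (2 *\<^sub>R (- w x - z *\<^sub>R w3 x)) - z *\<^sub>R (- w3 x - (w3 x + z *\<^sub>R w33 x))"
    unfolding p31 p1x by (simp add: eq_diff_eq)
  then show "partial S 1 (partial S 1 w) x = 2 *\<^sub>R w x + (4 * z) *\<^sub>R w3 x + z\<^sup>2 *\<^sub>R w33 x"
    by (simp add: vec_eq_iff algebra_simps power2_eq_square)

  \<comment> \<open>On this line the first coordinate stays 1 and the second is \<open>t\<close>, so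
    the rotation identity gives \<open>partial S 2 w\<close> for all \<open>t\<close> and can be
    differentiated at 0.\<close>
  have line: "x + t *\<^sub>R axis 2 1 \<in> half_space" for t
    using z by (simp add: half_space_def x_def axis_def)
  have "partial S 2 w (x + t *\<^sub>R axis 2 1) = rot90 (w (x + t *\<^sub>R axis 2 1)) + t *\<^sub>R partial S 1 w (x + t *\<^sub>R axis 2 1)" for t
    using axisymmetric_rotation[OF w S diff[OF smooth line] line] by (simp add: x_def axis_def)
  moreover have "((\<lambda>t. rot90 (w (x + t *\<^sub>R axis 2 1)) + t *\<^sub>R partial S 1 w (x + t *\<^sub>R axis 2 1)) has_vector_derivative
     rot90 (partial S 2 w x) + partial S 1 w x) (at 0)"
    using has_vector_derivative_partial[OF S diff[OF smooth x] x] has_vector_derivative_partial[OF S diff[OF smooth' x] x]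
    by (auto intro!: derivative_eq_intros bounded_linear.has_vector_derivative[OF bounded_linear_rot90])
  ultimately have "((\<lambda>t. partial S 2 w (x + t *\<^sub>R axis 2 1)) has_vector_derivative
     rot90 (partial S 2 w x) + partial S 1 w x) (at 0)"
    by simp
  from vector_derivative_unique_at[OF has_vector_derivative_partial[OF S diff[OF smooth' x] x] this]
  show "partial S 2 (partial S 2 w) x = rot90 (rot90 (w x)) - w x - z *\<^sub>R w3 x"
    by (simp add: p2 p1x)
qed

lemma smooth_on_differentiable_half_space:
  "smooth_on S f \<Longrightarrow> half_space \<subseteq> S \<Longrightarrow> x \<in> half_space \<Longrightarrow> f differentiable (at x within S)"
  using smooth_on_differentiable by blast

section \<open>Rotation equivariance of the differential operators\<close>

definition rot :: "real \<Rightarrow> real^3 \<Rightarrow> real^3" where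
  "rot \<theta> v = vector [cos \<theta> * v $ 1 - sin \<theta> * v $ 2, sin \<theta> * v $ 1 + cos \<theta> * v $ 2, v $ 3]"

lemma rot_nth [simp]:
  "rot \<theta> v $ 1 = cos \<theta> * v $ 1 - sin \<theta> * v $ 2" "rot \<theta> v $ 2 = sin \<theta> * v $ 1 + cos \<theta> * v $ 2" "rot \<theta> v $ 3 = v $ 3"
  by (simp_all add: rot_def)

lemma bounded_linear_rot: "bounded_linear (rot \<theta>)"
  unfolding linear_conv_bounded_linear[symmetric]
  by (rule linearI) (simp_all add: vec_eq_iff forall_3 algebra_simps)

lemma cyl_point_rot: "cyl_point r \<theta> z = rot \<theta> (vector [r, 0, z])"
  by (simp add: cyl_point_def vec_eq_iff forall_3)

text \<open>\<open>axisymmetric_with\<close> gives no information on the axis, so rotation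
  identities start from this set; being open, it allows them to be differentiated.\<close>

definition off_axis :: "(real^3) set" where
  "off_axis = {x \<in> half_space. x $ 1 \<noteq> 0 \<or> x $ 2 \<noteq> 0}"

lemma off_axis_half_space: "x \<in> off_axis \<Longrightarrow> x \<in> half_space"
  by (simp add: off_axis_def)

lemma open_off_axis: "open off_axis"
proof -
  have eq: "off_axis = half_space \<inter> ({x. x $ 1 \<noteq> 0} \<union> {x. x $ 2 \<noteq> 0})"
    by (auto simp: off_axis_def)
  show ?thesis
    unfolding eq by (intro open_Int open_Un open_half_space open_Collect_neq continuous_intros)
qed

lemma rot_half_space: "x \<in> half_space \<Longrightarrow> rot \<theta> x \<in> half_space"
  by (simp add: half_space_def)

lemma axisymmetric_rot:
  assumes w: "axisymmetric_with w wr wt wz" and x: "x \<in> off_axis"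
  shows "w (rot \<theta> x) = rot \<theta> (w x)"
proof -
  from x have "x $ 1 \<noteq> 0 \<or> x $ 2 \<noteq> 0" by (simp add: off_axis_def)
  then obtain r \<phi> where r: "r > 0" and x_eq: "x = cyl_point r \<phi> (x $ 3)"
    using cylindrical_coordinates by blast
  define z where "z = x $ 3"
  have z: "z > 0" using x by (simp add: z_def off_axis_def half_space_def)
  have xc: "x = cyl_point r \<phi> z" using x_eq by (simp add: z_def)
  have rot_eq: "rot \<theta> (cyl_point r \<phi> z) = cyl_point r (\<theta> + \<phi>) z"
    by (simp add: cyl_point_def vec_eq_iff forall_3 cos_add sin_add algebra_simps)
  show ?thesis
    unfolding xc rot_eq axisymmetric_cyl_point[OF w r z]
    by (simp add: vec_eq_iff forall_3 cos_add sin_add algebra_simps)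
qed

text \<open>The chain rule expresses the partials of \<open>f\<close> at \<open>x\<close> through
  those of \<open>g\<close> at the rotated point, and the rotation matrix is then inverted. Two
  functions appear because rotation mixes the partials of an equivariant field, so these are not
  equivariant one by one.\<close>

lemma partial_rot:
  fixes f g :: "real^3 \<Rightarrow> 'b::real_normed_vector"
  assumes S: "half_space \<subseteq> S"
    and f: "\<And>x. x \<in> half_space \<Longrightarrow> f differentiable (at x within S)"
    and g: "\<And>x. x \<in> half_space \<Longrightarrow> g differentiable (at x within S)"
    and eq: "\<And>x. x \<in> off_axis \<Longrightarrow> g (rot \<theta> x) = f x" and x: "x \<in> off_axis"
  shows "partial S 1 g (rot \<theta> x) = cos \<theta> *\<^sub>R partial S 1 f x - sin \<theta> *\<^sub>R partial S 2 f x"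
    and "partial S 2 g (rot \<theta> x) = sin \<theta> *\<^sub>R partial S 1 f x + cos \<theta> *\<^sub>R partial S 2 f x"
    and "partial S 3 g (rot \<theta> x) = partial S 3 f x"
proof -
  let ?R = "rot \<theta>"
  have main: "partial S i f x = ?R (axis i 1) $ 1 *\<^sub>R partial S 1 g (?R x)
    + ?R (axis i 1) $ 2 *\<^sub>R partial S 2 g (?R x) + ?R (axis i 1) $ 3 *\<^sub>R partial S 3 g (?R x)" for i
  proof -
    define T where "T = {t. x + t *\<^sub>R axis i 1 \<in> off_axis}"
    have T: "open T"
      unfolding T_def using open_off_axis
      by (intro open_vimage[unfolded vimage_def]) (auto intro!: continuous_intros)
    have "0 \<in> T" using x by (simp add: T_def)
    have "((\<lambda>t. x + t *\<^sub>R axis i 1) has_vector_derivative axis i 1) (at 0 within T)"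
      by (auto intro!: derivative_eq_intros)
    from bounded_linear.has_vector_derivative[OF bounded_linear_rot this]
    have "((\<lambda>t. ?R (x + t *\<^sub>R axis i 1)) has_vector_derivative ?R (axis i 1)) (at 0 within T)" .
    moreover have "(\<lambda>t. ?R (x + t *\<^sub>R axis i 1)) ` T \<subseteq> S"
      using rot_half_space off_axis_half_space S by (auto simp: T_def)
    moreover have "g differentiable (at (?R (x + 0 *\<^sub>R axis i 1)) within S)"
      using g rot_half_space off_axis_half_space[OF x] by simp
    ultimately have "((\<lambda>t. g (?R (x + t *\<^sub>R axis i 1))) has_vector_derivative
        ?R (axis i 1) $ 1 *\<^sub>R partial S 1 g (?R x)
    + ?R (axis i 1) $ 2 *\<^sub>R partial S 2 g (?R x) + ?R (axis i 1) $ 3 *\<^sub>R partial S 3 g (?R x)) (at 0 within T)"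
      using has_vector_derivative_along_curve[of g "\<lambda>t. ?R (x + t *\<^sub>R axis i 1)" 0 S "?R (axis i 1)" T] by simp
    then have "((\<lambda>t. g (?R (x + t *\<^sub>R axis i 1))) has_vector_derivative
        ?R (axis i 1) $ 1 *\<^sub>R partial S 1 g (?R x)
    + ?R (axis i 1) $ 2 *\<^sub>R partial S 2 g (?R x) + ?R (axis i 1) $ 3 *\<^sub>R partial S 3 g (?R x)) (at 0)"
      using at_within_open[OF \<open>0 \<in> T\<close> T] by simp
    then have "((\<lambda>t. f (x + t *\<^sub>R axis i 1)) has_vector_derivative
        ?R (axis i 1) $ 1 *\<^sub>R partial S 1 g (?R x)
    + ?R (axis i 1) $ 2 *\<^sub>R partial S 2 g (?R x) + ?R (axis i 1) $ 3 *\<^sub>R partial S 3 g (?R x)) (at 0)"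
      by (rule has_vector_derivative_transform_within_open[OF _ T \<open>0 \<in> T\<close>]) (simp add: eq T_def)
    then show ?thesis
      using vector_derivative_unique_at has_vector_derivative_partial[OF S f[OF off_axis_half_space[OF x]] off_axis_half_space[OF x]]
      by blast
  qed
  have 1: "partial S 1 f x = cos \<theta> *\<^sub>R partial S 1 g (?R x) + sin \<theta> *\<^sub>R partial S 2 g (?R x)"
    using main[of 1] by (simp add: axis_def)
  have 2: "partial S 2 f x = cos \<theta> *\<^sub>R partial S 2 g (?R x) - sin \<theta> *\<^sub>R partial S 1 g (?R x)"
    using main[of 2] by (simp add: axis_def)
  have inverse: "c *\<^sub>R (c *\<^sub>R X + s *\<^sub>R Y) - s *\<^sub>R (c *\<^sub>R Y - s *\<^sub>R X) = X"
    "s *\<^sub>R (c *\<^sub>R X + s *\<^sub>R Y) + c *\<^sub>R (c *\<^sub>R Y - s *\<^sub>R X) = Y"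
    if "c\<^sup>2 + s\<^sup>2 = 1" for c s :: real and X Y :: 'b
  proof -
    have "c *\<^sub>R (c *\<^sub>R X + s *\<^sub>R Y) - s *\<^sub>R (c *\<^sub>R Y - s *\<^sub>R X) = (c\<^sup>2 + s\<^sup>2) *\<^sub>R X"
      by (simp add: algebra_simps power2_eq_square)
    then show "c *\<^sub>R (c *\<^sub>R X + s *\<^sub>R Y) - s *\<^sub>R (c *\<^sub>R Y - s *\<^sub>R X) = X"
      using that by simp
    have "s *\<^sub>R (c *\<^sub>R X + s *\<^sub>R Y) + c *\<^sub>R (c *\<^sub>R Y - s *\<^sub>R X) = (c\<^sup>2 + s\<^sup>2) *\<^sub>R Y"
      by (simp add: algebra_simps power2_eq_square)
    then show "s *\<^sub>R (c *\<^sub>R X + s *\<^sub>R Y) + c *\<^sub>R (c *\<^sub>R Y - s *\<^sub>R X) = Y"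
      using that by simp
  qed
  show "partial S 1 g (rot \<theta> x) = cos \<theta> *\<^sub>R partial S 1 f x - sin \<theta> *\<^sub>R partial S 2 f x"
    "partial S 2 g (rot \<theta> x) = sin \<theta> *\<^sub>R partial S 1 f x + cos \<theta> *\<^sub>R partial S 2 f x"
    unfolding 1 2 using inverse[of "cos \<theta>" "sin \<theta>"] by simp_all
  show "partial S 3 g (rot \<theta> x) = partial S 3 f x"
    using main[of 3] by (simp add: axis_def)
qed

text \<open>The rotation laws for first partials have right-hand sides of this shape, so
  \<open>partial_rot\<close> can be applied to them a second time.\<close>

lemma partial_linear_combination:
  fixes f g :: "real^3 \<Rightarrow> 'b::real_normed_vector"
  assumes S: "half_space \<subseteq> S" and A: "bounded_linear A" and x: "x \<in> half_space"
    and f: "f differentiable (at x within S)" and g: "g differentiable (at x within S)"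
  shows "(\<lambda>x. A (a *\<^sub>R f x + b *\<^sub>R g x)) differentiable (at x within S)"
    and "partial S i (\<lambda>x. A (a *\<^sub>R f x + b *\<^sub>R g x)) x = A (a *\<^sub>R partial S i f x + b *\<^sub>R partial S i g x)"
proof -
  have at: "at x within S = at x"
    by (rule at_within_half_space[OF S x])
  have "((\<lambda>x. A (a *\<^sub>R f x + b *\<^sub>R g x)) has_derivative
      (\<lambda>h. A (a *\<^sub>R frechet_derivative f (at x) h + b *\<^sub>R frechet_derivative g (at x) h))) (at x)"
    using f g unfolding at frechet_derivative_works
    by (intro bounded_linear.has_derivative[OF A] has_derivative_add has_derivative_scaleR_right)
  then show "(\<lambda>x. A (a *\<^sub>R f x + b *\<^sub>R g x)) differentiable (at x within S)"
    "partial S i (\<lambda>x. A (a *\<^sub>R f x + b *\<^sub>R g x)) x = A (a *\<^sub>R partial S i f x + b *\<^sub>R partial S i g x)"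
    unfolding at partial_def differentiable_def
    by (auto dest: frechet_derivative_at[symmetric])
qed

lemma axisymmetric_partial_rot:
  fixes w :: "real^3 \<Rightarrow> real^3"
  assumes w: "axisymmetric_with w wr wt wz" and smooth: "smooth_on S w" and S: "half_space \<subseteq> S"
    and x: "x \<in> off_axis"
  shows "partial S 1 w (rot \<theta> x) = rot \<theta> (cos \<theta> *\<^sub>R partial S 1 w x + (- sin \<theta>) *\<^sub>R partial S 2 w x)"
    and "partial S 2 w (rot \<theta> x) = rot \<theta> (sin \<theta> *\<^sub>R partial S 1 w x + cos \<theta> *\<^sub>R partial S 2 w x)"
    and "partial S 3 w (rot \<theta> x) = rot \<theta> (1 *\<^sub>R partial S 3 w x + 0 *\<^sub>R partial S 3 w x)"
proof -
  note diff = smooth_on_differentiable_half_space[OF smooth S]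
  interpret R: bounded_linear "rot \<theta>" by (rule bounded_linear_rot)
  have xh: "x \<in> half_space" by (rule off_axis_half_space[OF x])
  \<comment> \<open>The coefficients 1 and 0 bring the rotated field into the shape of
    \<open>partial_linear_combination\<close>.\<close>
  have lin: "(\<lambda>x. rot \<theta> (1 *\<^sub>R w x + 0 *\<^sub>R w x)) differentiable (at y within S)"
    "partial S i (\<lambda>x. rot \<theta> (1 *\<^sub>R w x + 0 *\<^sub>R w x)) y = rot \<theta> (1 *\<^sub>R partial S i w y + 0 *\<^sub>R partial S i w y)"
    if "y \<in> half_space" for y i
    by (rule partial_linear_combination[OF S bounded_linear_rot that diff[OF that] diff[OF that]])+
  have eq: "w (rot \<theta> y) = rot \<theta> (1 *\<^sub>R w y + 0 *\<^sub>R w y)" if "y \<in> off_axis" for y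
    using axisymmetric_rot[OF w that] by simp
  note rot = partial_rot[OF S lin(1) diff eq x, unfolded lin(2)[OF xh]]
  show "partial S 1 w (rot \<theta> x) = rot \<theta> (cos \<theta> *\<^sub>R partial S 1 w x + (- sin \<theta>) *\<^sub>R partial S 2 w x)"
    using rot(1) by (simp add: R.add R.scaleR R.diff)
  show "partial S 2 w (rot \<theta> x) = rot \<theta> (sin \<theta> *\<^sub>R partial S 1 w x + cos \<theta> *\<^sub>R partial S 2 w x)"
    using rot(2) by (simp add: R.add R.scaleR R.diff)
  show "partial S 3 w (rot \<theta> x) = rot \<theta> (1 *\<^sub>R partial S 3 w x + 0 *\<^sub>R partial S 3 w x)"
    by (rule rot(3))
qed

text \<open>\<open>partial_rot\<close> is applied twice. In the sum over the horizontal directions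
  the mixed second partials cancel, separately for each order of differentiation, and the pure ones
  combine by cos^2 + sin^2 = 1.\<close>

lemma axisymmetric_laplacian_rot:
  fixes w :: "real^3 \<Rightarrow> real^3"
  assumes w: "axisymmetric_with w wr wt wz" and smooth: "smooth_on S w" and S: "half_space \<subseteq> S"
    and x: "x \<in> off_axis"
  shows "laplacian S w (rot \<theta> x) = rot \<theta> (laplacian S w x)"
proof -
  note diff = smooth_on_differentiable_half_space[OF smooth_on_partial[OF smooth] S]
  have lin: "(\<lambda>x. rot \<theta> (a *\<^sub>R partial S j w x + b *\<^sub>R partial S k w x)) differentiable (at y within S)"
    "partial S i (\<lambda>x. rot \<theta> (a *\<^sub>R partial S j w x + b *\<^sub>R partial S k w x)) y
      = rot \<theta> (a *\<^sub>R partial S i (partial S j w) y + b *\<^sub>R partial S i (partial S k w) y)"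
    if "y \<in> half_space" for y a b i j k
    by (rule partial_linear_combination[OF S bounded_linear_rot that diff[OF that] diff[OF that]])+
  note first = axisymmetric_partial_rot[OF w smooth S]
  have xh: "x \<in> half_space" by (rule off_axis_half_space[OF x])
  have "partial S 1 (partial S 1 w) (rot \<theta> x) =
      cos \<theta> *\<^sub>R rot \<theta> (cos \<theta> *\<^sub>R partial S 1 (partial S 1 w) x + (- sin \<theta>) *\<^sub>R partial S 1 (partial S 2 w) x)
      - sin \<theta> *\<^sub>R rot \<theta> (cos \<theta> *\<^sub>R partial S 2 (partial S 1 w) x + (- sin \<theta>) *\<^sub>R partial S 2 (partial S 2 w) x)"
    using partial_rot(1)[OF S lin(1) diff first(1) x] by (simp only: lin(2)[OF xh])
  moreover have "partial S 2 (partial S 2 w) (rot \<theta> x) =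
      sin \<theta> *\<^sub>R rot \<theta> (sin \<theta> *\<^sub>R partial S 1 (partial S 1 w) x + cos \<theta> *\<^sub>R partial S 1 (partial S 2 w) x)
      + cos \<theta> *\<^sub>R rot \<theta> (sin \<theta> *\<^sub>R partial S 2 (partial S 1 w) x + cos \<theta> *\<^sub>R partial S 2 (partial S 2 w) x)"
    using partial_rot(2)[OF S lin(1) diff first(2) x] by (simp only: lin(2)[OF xh])
  moreover have "partial S 3 (partial S 3 w) (rot \<theta> x) =
      rot \<theta> (1 *\<^sub>R partial S 3 (partial S 3 w) x + 0 *\<^sub>R partial S 3 (partial S 3 w) x)"
    using partial_rot(3)[OF S lin(1) diff first(3) x] by (simp only: lin(2)[OF xh])
  moreover have "cos \<theta> *\<^sub>R rot \<theta> (cos \<theta> *\<^sub>R X + (- sin \<theta>) *\<^sub>R Y) - sin \<theta> *\<^sub>R rot \<theta> (cos \<theta> *\<^sub>R Z + (- sin \<theta>) *\<^sub>R U)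
     + (sin \<theta> *\<^sub>R rot \<theta> (sin \<theta> *\<^sub>R X + cos \<theta> *\<^sub>R Y) + cos \<theta> *\<^sub>R rot \<theta> (sin \<theta> *\<^sub>R Z + cos \<theta> *\<^sub>R U))
     + rot \<theta> (1 *\<^sub>R V + 0 *\<^sub>R V) = rot \<theta> (X + U + V)" for X Y Z U V
  proof -
    interpret R: bounded_linear "rot \<theta>" by (rule bounded_linear_rot)
    have "cos \<theta> *\<^sub>R rot \<theta> (cos \<theta> *\<^sub>R X + (- sin \<theta>) *\<^sub>R Y) - sin \<theta> *\<^sub>R rot \<theta> (cos \<theta> *\<^sub>R Z + (- sin \<theta>) *\<^sub>R U)
     + (sin \<theta> *\<^sub>R rot \<theta> (sin \<theta> *\<^sub>R X + cos \<theta> *\<^sub>R Y) + cos \<theta> *\<^sub>R rot \<theta> (sin \<theta> *\<^sub>R Z + cos \<theta> *\<^sub>R U))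
      = ((cos \<theta>)\<^sup>2 + (sin \<theta>)\<^sup>2) *\<^sub>R rot \<theta> X + ((cos \<theta>)\<^sup>2 + (sin \<theta>)\<^sup>2) *\<^sub>R rot \<theta> U"
      by (simp only: R.add R.scaleR scaleR_add_right scaleR_add_left power2_eq_square) (simp add: algebra_simps)
    then show ?thesis by (simp add: R.add)
  qed
  ultimately show ?thesis
    by (simp only: laplacian_def sum_3)
qed

text \<open>The components of \<open>v\<close> and the partials of \<open>w\<close> transform by the
  same orthogonal matrix, so their contraction is preserved and only the rotation of the values is
  left.\<close>

lemma axisymmetric_advection_rot:
  fixes v w :: "real^3 \<Rightarrow> real^3"
  assumes v: "axisymmetric_with v vr vt vz"
    and w: "axisymmetric_with w wr wt wz" and smooth: "smooth_on S w" and S: "half_space \<subseteq> S"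
    and x: "x \<in> off_axis"
  shows "advection S v w (rot \<theta> x) = rot \<theta> (advection S v w x)"
proof -
  interpret R: bounded_linear "rot \<theta>" by (rule bounded_linear_rot)
  have "(cos \<theta> * a - sin \<theta> * b) *\<^sub>R rot \<theta> (cos \<theta> *\<^sub>R X + (- sin \<theta>) *\<^sub>R Y)
      + (sin \<theta> * a + cos \<theta> * b) *\<^sub>R rot \<theta> (sin \<theta> *\<^sub>R X + cos \<theta> *\<^sub>R Y)
      = ((cos \<theta>)\<^sup>2 + (sin \<theta>)\<^sup>2) *\<^sub>R a *\<^sub>R rot \<theta> X + ((cos \<theta>)\<^sup>2 + (sin \<theta>)\<^sup>2) *\<^sub>R b *\<^sub>R rot \<theta> Y" for a b X Y
    by (simp only: R.add R.scaleR scaleR_add_right scaleR_add_left scaleR_diff_left power2_eq_square) (simp add: algebra_simps)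
  then have "(cos \<theta> * a - sin \<theta> * b) *\<^sub>R rot \<theta> (cos \<theta> *\<^sub>R X + (- sin \<theta>) *\<^sub>R Y)
      + (sin \<theta> * a + cos \<theta> * b) *\<^sub>R rot \<theta> (sin \<theta> *\<^sub>R X + cos \<theta> *\<^sub>R Y)
      = a *\<^sub>R rot \<theta> X + b *\<^sub>R rot \<theta> Y" for a b X Y
    by simp
  note comb = this
  show ?thesis
    unfolding advection_def sum_3 axisymmetric_rot[OF v x] axisymmetric_partial_rot[OF w smooth S x] rot_nth comb
    by (simp add: R.add R.scaleR)
qed

lemma operators_half_space_eq:
  assumes "half_space \<subseteq> S" "x \<in> half_space"
  shows "laplacian half_space w x = laplacian S w x"
    and "advection half_space v w x = advection S v w x"
    and "divergence half_space w x = divergence S w x"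
  by (simp_all only: laplacian_def partial_partial_half_space_eq[OF assms])
    (simp_all only: advection_def divergence_def partial_half_space_eq[OF assms])

lemma cyl_line_off_axis: "z > 0 \<Longrightarrow> cyl_line z \<in> off_axis"
  by (simp add: off_axis_def cyl_line_half_space)

text \<open>Applying \<open>rot90\<close> twice gives minus the horizontal part, which cancels the
  zeroth order term of the Laplacian except in the vertical component.\<close>

lemma operators_cyl_line:
  fixes w :: "real^3 \<Rightarrow> real^3"
  assumes w: "axisymmetric_with w wr wt wz" and smooth: "smooth_on S w" and S: "half_space \<subseteq> S"
    and hom: "\<And>\<mu> x. \<mu> > 0 \<Longrightarrow> x \<in> half_space \<Longrightarrow> w x = \<mu> *\<^sub>R w (\<mu> *\<^sub>R x)"
    and z: "z > 0"
  defines "x \<equiv> cyl_line z" and "w3 \<equiv> partial S 3 w" and "w33 \<equiv> partial S 3 (partial S 3 w)"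
  shows "laplacian S w x = (1 + z\<^sup>2) *\<^sub>R w33 x + (3 * z) *\<^sub>R w3 x + vector [0, 0, w x $ 3]"
    and "advection S v w x = (v x $ 3 - z * v x $ 1) *\<^sub>R w3 x - v x $ 1 *\<^sub>R w x + v x $ 2 *\<^sub>R rot90 (w x)"
    and "divergence S w x = w3 x $ 3 - z * w3 x $ 1"
proof -
  note partials = axisymmetric_homogeneous_partials[OF w smooth S hom z]
  show "laplacian S w x = (1 + z\<^sup>2) *\<^sub>R w33 x + (3 * z) *\<^sub>R w3 x + vector [0, 0, w x $ 3]"
    by (simp add: laplacian_def sum_3 partials(3,4) x_def w3_def w33_def) (simp add: vec_eq_iff forall_3 algebra_simps)
  show "advection S v w x = (v x $ 3 - z * v x $ 1) *\<^sub>R w3 x - v x $ 1 *\<^sub>R w x + v x $ 2 *\<^sub>R rot90 (w x)"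
    by (simp add: advection_def sum_3 partials(1,2) x_def w3_def) (simp add: vec_eq_iff forall_3 algebra_simps)
  show "divergence S w x = w3 x $ 3 - z * w3 x $ 1"
    by (simp add: divergence_def sum_3 partials(1,2) x_def w3_def)
qed

text \<open>
  The pressure is not assumed axisymmetric. Since the momentum equation makes its angular derivative
  constant along circles, periodicity forces this derivative to vanish.
\<close>

lemma azimuthal_gradient_zero:
  assumes p: "smooth_on half_space p" and z: "z > 0"
    and grad: "\<And>\<theta>. gradient half_space p (rot \<theta> (cyl_line z)) = rot \<theta> F"
  shows "F $ 2 = 0"
proof -
  define \<phi> where "\<phi> = (\<lambda>\<theta>. p (cyl_point 1 \<theta> z))"
  have deriv: "(\<phi> has_real_derivative F $ 2) (at \<theta>)" for \<theta>
  proof -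
    have cyl: "cyl_point 1 \<theta> z = rot \<theta> (cyl_line z)" for \<theta>
      by (simp add: cyl_point_rot cyl_line_def)
    have "((\<lambda>\<theta>. cyl_point 1 \<theta> z) has_vector_derivative vector [- sin \<theta>, cos \<theta>, 0]) (at \<theta>)"
      unfolding cyl_point_def
      by (rule has_vector_derivative_vector_3) (auto intro!: derivative_eq_intros)
    from has_vector_derivative_along_curve[OF _ this, of p half_space]
    have "(\<phi> has_vector_derivative
        - sin \<theta> *\<^sub>R partial half_space 1 p (cyl_point 1 \<theta> z) + cos \<theta> *\<^sub>R partial half_space 2 p (cyl_point 1 \<theta> z)) (at \<theta>)"
      using smooth_on_differentiable[OF p] cyl_point_in_half_space[OF z] by (auto simp: \<phi>_def)
    moreover have "partial half_space i p (cyl_point 1 \<theta> z) = rot \<theta> F $ i" for i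
      using grad[of \<theta>] by (simp add: gradient_def cyl vec_eq_iff)
    \<comment> \<open>The component of \<open>rot \<theta> F\<close> along the tangent of the circle
      is the same at every angle.\<close>
    moreover have "- sin \<theta> *\<^sub>R rot \<theta> F $ 1 + cos \<theta> *\<^sub>R rot \<theta> F $ 2 = ((sin \<theta>)\<^sup>2 + (cos \<theta>)\<^sup>2) * F $ 2"
      by (simp add: algebra_simps power2_eq_square del: sin_cos_squared_add sin_cos_squared_add2 sin_cos_squared_add3)
    ultimately show ?thesis
      by (simp add: has_real_derivative_iff_has_vector_derivative)
  qed
  obtain \<theta> where "\<phi> (2 * pi) - \<phi> 0 = (2 * pi - 0) * F $ 2"
    using MVT2[of 0 "2 * pi" \<phi> "\<lambda>_. F $ 2"] deriv by auto
  then show ?thesis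
    by (simp add: \<phi>_def cyl_point_def)
qed

section \<open>Limits towards the axis\<close>

definition horizontal_line :: "real \<Rightarrow> real^3" where
  "horizontal_line s = vector [s, 0, 1]"

lemma horizontal_line_half_space: "horizontal_line s \<in> half_space"
  by (simp add: horizontal_line_def half_space_def)

lemma horizontal_line_derivative:
  assumes "smooth_on S f" "half_space \<subseteq> S"
  shows "((\<lambda>s. f (horizontal_line s)) has_vector_derivative partial S 1 f (horizontal_line 0)) (at 0)"
proof -
  have eq: "horizontal_line 0 + t *\<^sub>R axis 1 1 = horizontal_line t" for t
    by (simp add: horizontal_line_def axis_def vec_eq_iff forall_3)
  show ?thesis
    using has_vector_derivative_partial[OF assms(2) smooth_on_differentiable_half_space[OF assms horizontal_line_half_space]
        horizontal_line_half_space, of 0 1] by (simp only: eq)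
qed

lemma filterlim_inverse_at_0: "filterlim (\<lambda>z::real. 1 / z) (at 0) at_top"
  using filterlim_mono[OF filterlim_inverse_at_right_top at_le[OF subset_UNIV] order.refl]
  by (simp add: inverse_eq_divide)

text \<open>Scaling by \<open>z\<close> carries \<open>horizontal_line (1 / z)\<close> to
  \<open>cyl_line z\<close>, so the behaviour at infinity is continuity at the interior point (0, 0,
  1).\<close>

lemma homogeneous_cyl_line_limit:
  fixes f :: "real^3 \<Rightarrow> 'b::real_normed_vector"
  assumes smooth: "smooth_on S f" and S: "half_space \<subseteq> S"
    and hom: "\<And>\<mu> x. \<mu> > 0 \<Longrightarrow> x \<in> half_space \<Longrightarrow> f x = \<mu> ^ n *\<^sub>R f (\<mu> *\<^sub>R x)"
  shows "((\<lambda>z. z ^ n *\<^sub>R f (cyl_line z)) \<longlongrightarrow> f (horizontal_line 0)) at_top"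
proof -
  have "isCont (\<lambda>s. f (horizontal_line s)) 0"
    using horizontal_line_derivative[OF smooth S] has_vector_derivative_continuous by blast
  then have "((\<lambda>z. f (horizontal_line (1 / z))) \<longlongrightarrow> f (horizontal_line 0)) at_top"
    unfolding isCont_def by (rule filterlim_compose[OF _ filterlim_inverse_at_0])
  moreover have "eventually (\<lambda>z. f (horizontal_line (1 / z)) = z ^ n *\<^sub>R f (cyl_line z)) at_top"
    using eventually_gt_at_top[of 0]
  proof eventually_elim
    case (elim z)
    have "z *\<^sub>R horizontal_line (1 / z) = cyl_line z"
      using elim by (simp add: horizontal_line_def vec_eq_iff forall_3)
    then show ?case
      using hom[OF elim horizontal_line_half_space] by metis
  qed
  ultimately show ?thesis
    by (rule Lim_transform_eventually)
qed

text \<open>Rotation by \<open>pi\<close> reverses the horizontal components, which are therefore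
  odd along a horizontal line through the axis and vanish on it by continuity.\<close>

lemma axisymmetric_zero_on_axis:
  assumes w: "axisymmetric_with w wr wt wz" and smooth: "smooth_on S w" and S: "half_space \<subseteq> S"
    and i: "i \<in> {1, 2}"
  shows "w (horizontal_line 0) $ i = 0"
proof -
  define f where "f = (\<lambda>s. w (horizontal_line s) $ i)"
  have "isCont f 0"
    using has_real_derivative_component[OF horizontal_line_derivative[OF smooth S]] DERIV_isCont
    unfolding f_def by blast
  then have f: "(f \<longlongrightarrow> f 0) (at 0)"
    by (simp add: isCont_def)
  have "filterlim uminus (at 0) (at (0::real))"
    by (auto simp: filterlim_at eventually_at_filter intro!: tendsto_eq_intros)
  from filterlim_compose[OF f this] have "((\<lambda>s. f (- s)) \<longlongrightarrow> f 0) (at 0)" .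
  moreover have "f (- s) = - f s" if "s \<noteq> 0" for s
  proof -
    have "horizontal_line s \<in> off_axis"
      using that horizontal_line_half_space by (simp add: off_axis_def horizontal_line_def)
    moreover have "rot pi (horizontal_line s) = horizontal_line (- s)"
      by (simp add: horizontal_line_def vec_eq_iff forall_3)
    ultimately have "w (horizontal_line (- s)) = rot pi (w (horizontal_line s))"
      using axisymmetric_rot[OF w] by metis
    then show ?thesis using i by (auto simp: f_def)
  qed
  then have "eventually (\<lambda>s. f (- s) = - f s) (at 0)"
    by (simp add: eventually_at_filter)
  ultimately have "((\<lambda>s. - f s) \<longlongrightarrow> f 0) (at 0)"
    by (rule Lim_transform_eventually)
  from tendsto_unique[OF _ this tendsto_minus[OF f]] show ?thesis
    by (simp add: f_def)
qed

text \<open>Vanishing on the axis improves the decay by one order beyond homogeneity: the expression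
  is the difference quotient at the axis with increment \<open>1 / z\<close>.\<close>

lemma axisymmetric_cyl_line_limit:
  assumes w: "axisymmetric_with w wr wt wz" and smooth: "smooth_on S w" and S: "half_space \<subseteq> S"
    and hom: "\<And>\<mu> x. \<mu> > 0 \<Longrightarrow> x \<in> half_space \<Longrightarrow> w x = \<mu> *\<^sub>R w (\<mu> *\<^sub>R x)"
    and i: "i \<in> {1, 2}"
  shows "((\<lambda>z. z\<^sup>2 * w (cyl_line z) $ i) \<longlongrightarrow> partial S 1 w (horizontal_line 0) $ i) at_top"
proof -
  define f where "f = (\<lambda>s. w (horizontal_line s) $ i)"
  have "((\<lambda>h. (f (0 + h) - f 0) / h) \<longlongrightarrow> partial S 1 w (horizontal_line 0) $ i) (at 0)"
    using has_real_derivative_component[OF horizontal_line_derivative[OF smooth S]]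
    unfolding f_def DERIV_def by blast
  moreover have "f 0 = 0"
    unfolding f_def by (rule axisymmetric_zero_on_axis[OF w smooth S i])
  ultimately have "((\<lambda>h. f h / h) \<longlongrightarrow> partial S 1 w (horizontal_line 0) $ i) (at 0)"
    by simp
  from filterlim_compose[OF this filterlim_inverse_at_0]
  have "((\<lambda>z. f (1 / z) / (1 / z)) \<longlongrightarrow> partial S 1 w (horizontal_line 0) $ i) at_top" .
  moreover have "eventually (\<lambda>z. f (1 / z) / (1 / z) = z\<^sup>2 * w (cyl_line z) $ i) at_top"
    using eventually_gt_at_top[of 0]
  proof eventually_elim
    case (elim z)
    have "z *\<^sub>R horizontal_line (1 / z) = cyl_line z"
      using elim by (simp add: horizontal_line_def vec_eq_iff forall_3)
    then have "w (horizontal_line (1 / z)) = z *\<^sub>R w (cyl_line z)"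
      using hom[OF elim horizontal_line_half_space] by metis
    then show ?case by (simp add: f_def power2_eq_square)
  qed
  ultimately show ?thesis
    by (rule Lim_transform_eventually)
qed

lemma tendsto_zero_of_times:
  fixes f :: "real \<Rightarrow> real"
  assumes "((\<lambda>z. z * f z) \<longlongrightarrow> l) at_top"
  shows "(f \<longlongrightarrow> 0) at_top"
proof -
  have "((\<lambda>z. 1 / z * (z * f z)) \<longlongrightarrow> 0 * l) at_top"
    using filterlim_inverse_at_0 by (intro tendsto_mult assms) (simp add: filterlim_at)
  moreover have "eventually (\<lambda>z. 1 / z * (z * f z) = f z) at_top"
    using eventually_gt_at_top[of 0] by eventually_elim simp
  ultimately show ?thesis
    by (simp add: tendsto_cong)
qed

text \<open>Scaling and rotation carry the line to every point of the open half space off the axis;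
  the axis and the boundary follow by continuity.\<close>

lemma zero_of_zero_on_cyl_line:
  assumes w: "axisymmetric_with w wr wt wz" and smooth: "smooth_on half_space_closed w"
    and hom: "\<And>\<mu> x. \<mu> > 0 \<Longrightarrow> x \<in> half_space \<Longrightarrow> w x = \<mu> *\<^sub>R w (\<mu> *\<^sub>R x)"
    and zero: "\<And>z. z > 0 \<Longrightarrow> w (cyl_line z) = 0"
    and x: "x \<in> half_space_closed"
  shows "w x = 0"
proof -
  have off_axis: "w y = 0" if y: "y \<in> off_axis" for y
  proof -
    from y have "y $ 1 \<noteq> 0 \<or> y $ 2 \<noteq> 0" by (simp add: off_axis_def)
    then obtain r \<theta> where r: "r > 0" and y_eq: "y = cyl_point r \<theta> (y $ 3)"
      using cylindrical_coordinates by blast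
    have y3: "y $ 3 > 0" using y by (simp add: off_axis_def half_space_def)
    have "y = rot \<theta> (r *\<^sub>R cyl_line (y $ 3 / r))"
      using r by (subst y_eq) (simp add: cyl_point_rot vec_eq_iff forall_3)
    moreover have "w (r *\<^sub>R cyl_line (y $ 3 / r)) = 0"
      using hom[OF r cyl_line_half_space, of "y $ 3 / r"] zero[of "y $ 3 / r"] r y3 by simp
    moreover have "r *\<^sub>R cyl_line (y $ 3 / r) \<in> off_axis"
      using r y3 by (simp add: off_axis_def half_space_def)
    ultimately have "w y = rot \<theta> 0"
      using axisymmetric_rot[OF w, of "r *\<^sub>R cyl_line (y $ 3 / r)" \<theta>] by metis
    then show ?thesis by (simp add: vec_eq_iff forall_3)
  qed
  \<comment> \<open>The sign makes the curve move upwards and away from the plane where the first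
    coordinate is 0, so it lies in \<open>off_axis\<close> for every positive
    \<open>t\<close>.\<close>
  define \<sigma> :: real where "\<sigma> = (if x $ 1 \<ge> 0 then 1 else - 1)"
  define \<gamma> where "\<gamma> = (\<lambda>t::real. x + t *\<^sub>R vector [\<sigma>, 0, 1])"
  have x3: "x $ 3 \<ge> 0"
    using x by (auto simp: half_space_closed_def half_space_def half_space_boundary_def)
  have \<gamma>: "\<gamma> t \<in> off_axis" if "t > 0" for t
    using that x3 by (auto simp: \<gamma>_def \<sigma>_def off_axis_def half_space_def)
  have "(\<gamma> \<longlongrightarrow> x + 0 *\<^sub>R vector [\<sigma>, 0, 1]) (at_right 0)"
    unfolding \<gamma>_def by (intro tendsto_intros)
  moreover have pos: "eventually (\<lambda>t::real. t > 0) (at_right 0)"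
    by (simp add: eventually_at_right_less)
  moreover have "eventually (\<lambda>t. \<gamma> t \<in> half_space_closed) (at_right 0)"
    using pos by eventually_elim (use \<gamma> off_axis_half_space half_space_subset_closed in blast)
  ultimately have "((\<lambda>t. w (\<gamma> t)) \<longlongrightarrow> w x) (at_right 0)"
    using continuous_on_tendsto_compose[OF smooth_on_continuous[OF smooth] _ x] by simp
  moreover have "eventually (\<lambda>t. w (\<gamma> t) = 0) (at_right 0)"
    using pos by eventually_elim (use \<gamma> off_axis in blast)
  ultimately have "((\<lambda>_::real. 0) \<longlongrightarrow> w x) (at_right 0)"
    by (rule Lim_transform_eventually)
  then show ?thesis
    by (simp add: tendsto_const_iff)
qed

section \<open>Boundary conditions at the point (1, 0, 0)\<close>

lemma tangential_partial_zero:
  fixes w :: "real^3 \<Rightarrow> real^3"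
  assumes smooth: "smooth_on half_space_closed w" and i: "i \<in> {1, 2}"
    and zero: "\<And>x. x \<in> half_space_boundary \<Longrightarrow> w x $ k = 0" and x: "x = cyl_line 0"
  shows "partial half_space_closed i w x $ k = 0"
proof -
  \<comment> \<open>For parameters of modulus less than 1 the points (1 + t, 0, 0) and (1, t, 0)
    stay on the boundary and avoid the origin, so the component vanishes along the whole
    segment.\<close>
  define T where "T = {- 1<..<1::real}"
  define \<gamma> where "\<gamma> = (\<lambda>t::real. x + t *\<^sub>R axis i 1)"
  have T: "\<gamma> t \<in> half_space_boundary" if "t \<in> T" for t
    using i that by (auto simp: T_def \<gamma>_def x half_space_boundary_def axis_def vec_eq_iff forall_3)
  have "\<gamma> ` T \<subseteq> half_space_closed"
    using T by (auto simp: half_space_closed_def)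
  moreover have "(\<gamma> has_vector_derivative axis i 1) (at 0 within T)"
    unfolding \<gamma>_def by (auto intro!: derivative_eq_intros)
  moreover have "w differentiable (at (\<gamma> 0) within half_space_closed)"
    using smooth_on_differentiable[OF smooth] cyl_line_half_space_closed[of 0] by (simp add: \<gamma>_def x)
  ultimately have "((\<lambda>t. w (\<gamma> t)) has_vector_derivative partial half_space_closed i w x) (at 0 within T)"
    using has_vector_derivative_along_curve[of w \<gamma> 0 half_space_closed "axis i 1" T] i
    by (auto simp: \<gamma>_def axis_def)
  then have "((\<lambda>t. w (\<gamma> t)) has_vector_derivative partial half_space_closed i w x) (at 0)"
    using at_within_open[of 0 T] by (simp add: T_def)
  from has_real_derivative_component[OF this, of k]
  have "((\<lambda>t. w (\<gamma> t) $ k) has_real_derivative partial half_space_closed i w x $ k) (at 0)" .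
  moreover have "((\<lambda>t. w (\<gamma> t) $ k) has_real_derivative 0) (at 0)"
  proof (rule has_field_derivative_transform_within_open[of "\<lambda>_. 0" _ _ T])
    show "0 = w (\<gamma> t) $ k" if "t \<in> T" for t
      using zero[OF T[OF that]] by simp
  qed (auto simp: T_def)
  ultimately show ?thesis
    by (rule DERIV_unique)
qed

lemma cyl_line_0_boundary: "cyl_line 0 \<in> half_space_boundary"
  by (auto simp: half_space_boundary_def vec_eq_iff forall_3)

lemma inner_outward_normal: "v \<bullet> outward_normal = - (v $ 3)"
  by (simp add: outward_normal_def e_z_def inner_vec_def sum_3)

text \<open>The cross product with the normal retains the horizontal part of the curl. Its first
  component is the x_2 derivative of B_3 minus the x_3 derivative of B_2, and the former is a
  tangential derivative of a component that vanishes on the boundary.\<close>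

lemma magnetic_bc_cyl_line:
  assumes "magnetic_bc B" "smooth_on half_space_closed B"
  shows "partial half_space_closed 3 B (cyl_line 0) $ 2 = 0"
proof -
  have "B x $ 3 = 0" if "x \<in> half_space_boundary" for x
    using assms(1) that by (auto simp: magnetic_bc_def inner_outward_normal)
  then have "partial half_space_closed 2 B (cyl_line 0) $ 3 = 0"
    by (intro tangential_partial_zero[OF assms(2)]) auto
  moreover have "cross3 (curl half_space_closed B (cyl_line 0)) outward_normal = 0"
    using assms(1) cyl_line_0_boundary by (auto simp: magnetic_bc_def)
  ultimately show ?thesis
    by (simp add: cross3_def curl_def outward_normal_def e_z_def vec_eq_iff forall_3)
qed

text \<open>Under slip the tangential strain is, up to sign, half the sum of the x_3 derivative of
  u_i and the x_i derivative of u_3; the latter is tangential and vanishes. The disjunction lets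
  both boundary conditions be treated at once.\<close>

lemma velocity_bc_cyl_line:
  assumes bc: "no_slip_bc u B \<or> navier_slip_bc u B" and smooth: "smooth_on half_space_closed u"
  shows "u (cyl_line 0) $ 3 = 0"
    and "i \<in> {1, 2} \<Longrightarrow> u (cyl_line 0) $ i = 0 \<or> partial half_space_closed 3 u (cyl_line 0) $ i = 0"
proof -
  note x = cyl_line_0_boundary
  have u3: "u x $ 3 = 0" if "x \<in> half_space_boundary" for x
    using bc that by (auto simp: no_slip_bc_def navier_slip_bc_def inner_outward_normal)
  then show "u (cyl_line 0) $ 3 = 0" using x by blast
  assume i: "i \<in> {1, 2}"
  from bc show "u (cyl_line 0) $ i = 0 \<or> partial half_space_closed 3 u (cyl_line 0) $ i = 0"
  proof
    assume "no_slip_bc u B"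
    then show ?thesis using x by (simp add: no_slip_bc_def)
  next
    assume slip: "navier_slip_bc u B"
    have "norm (axis i 1 :: real^3) = 1"
      by (rule norm_axis_1)
    moreover have "(axis i 1 :: real^3) \<bullet> outward_normal = 0"
      using i by (auto simp: inner_outward_normal axis_def)
    ultimately have "(strain half_space_closed u (cyl_line 0) *v outward_normal) \<bullet> axis i 1 = 0"
      using slip x unfolding navier_slip_bc_def by blast
    moreover have "(strain half_space_closed u (cyl_line 0) *v outward_normal) \<bullet> axis i 1
       = - (partial half_space_closed 3 u (cyl_line 0) $ i + partial half_space_closed i u (cyl_line 0) $ 3) / 2"
      by (simp add: inner_axis strain_def matrix_vector_mult_def sum_3 outward_normal_def e_z_def
          jacobian_def matrix_def transpose_def partial_def field_simps)
    moreover have "partial half_space_closed i u (cyl_line 0) $ 3 = 0"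
      by (rule tangential_partial_zero[OF smooth i u3 refl])
    ultimately show ?thesis by simp
  qed
qed

section \<open>The MHD system\<close>

theorem theorem1p3:
  fixes u B :: "real^3 \<Rightarrow> real^3"
    and ur ut uz Bt :: "real \<Rightarrow> real \<Rightarrow> real"
  assumes "smooth_self_similar_solution u B"
    and "axisymmetric_with u ur ut uz"
    and "axisymmetric_with B (\<lambda>r z. 0) Bt (\<lambda>r z. 0)"
    and "no_slip_bc u B \<or> navier_slip_bc u B"
    and "\<And>r \<theta> z. r > 0 \<Longrightarrow> cyl_point r \<theta> z \<in> sphere 0 1 \<inter> half_space \<Longrightarrow>
           ur r z < 1 / (3 * r) + 2 * r / 3"
  shows "\<forall>x\<in>half_space_closed. u x = 0 \<and> B x = 0"
proof -
  note axu = assms(2) and axB = assms(3)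
  note S = half_space_subset_closed
  obtain p where su: "smooth_on half_space_closed u" and sB: "smooth_on half_space_closed B"
    and sp: "smooth_on half_space p" and mhd: "mhd_system u B p" and similar: "self_similar u B p"
    using assms(1) unfolding smooth_self_similar_solution_def by blast
  have hom_u: "u x = \<mu> *\<^sub>R u (\<mu> *\<^sub>R x)" and hom_B: "B x = \<mu> *\<^sub>R B (\<mu> *\<^sub>R x)"
    and hom_p: "p x = \<mu> ^ 2 *\<^sub>R p (\<mu> *\<^sub>R x)" if "\<mu> > 0" "x \<in> half_space" for \<mu> x
    using similar that unfolding self_similar_def real_scaleR_def by blast+

  \<comment> \<open>Derivatives within the closed half space give the profiles one-sided values at
    \<open>z = 0\<close>, where the boundary conditions are evaluated.\<close>
  define u3 where "u3 = partial half_space_closed 3 u"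
  define u33 where "u33 = partial half_space_closed 3 u3"
  define B3 where "B3 = partial half_space_closed 3 B"
  define B33 where "B33 = partial half_space_closed 3 B3"
  have su3: "smooth_on half_space_closed u3" and sB3: "smooth_on half_space_closed B3"
    unfolding u3_def B3_def by (rule smooth_on_partial su sB)+
  have cont: "continuous_on {0..} (\<lambda>z. f (cyl_line z) $ i)" if "smooth_on half_space_closed f"
    for f :: "real^3 \<Rightarrow> real^3" and i
    using cyl_line_continuous[OF that] by (rule continuous_on_component)
  have deriv: "((\<lambda>z. f (cyl_line z) $ i) has_real_derivative partial half_space_closed 3 f (cyl_line z) $ i) (at z)"
    if "smooth_on half_space_closed f" "z > 0" for f :: "real^3 \<Rightarrow> real^3" and i z
    by (rule has_real_derivative_component[OF cyl_line_derivative[OF that(1) S that(2)]])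
  note du = deriv[OF su, folded u3_def] and du3 = deriv[OF su3, folded u33_def]
    and dB = deriv[OF sB, folded B3_def] and dB3 = deriv[OF sB3, folded B33_def]

  define a where "a = (\<lambda>z. u (cyl_line z) $ 1)"
  define b where "b = (\<lambda>z. u (cyl_line z) $ 2)"
  define c where "c = (\<lambda>z. u (cyl_line z) $ 3)"
  define k where "k = (\<lambda>z. B (cyl_line z) $ 2)"
  define q where "q = (\<lambda>z. p (cyl_line z))"
  define a1 where "a1 = (\<lambda>z. u3 (cyl_line z) $ 1)"
  define b1 where "b1 = (\<lambda>z. u3 (cyl_line z) $ 2)"
  define c1 where "c1 = (\<lambda>z. u3 (cyl_line z) $ 3)"
  define k1 where "k1 = (\<lambda>z. B3 (cyl_line z) $ 2)"
  define q1 where "q1 = (\<lambda>z. partial half_space 3 p (cyl_line z))"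
  define a2 where "a2 = (\<lambda>z. u33 (cyl_line z) $ 1)"
  define b2 where "b2 = (\<lambda>z. u33 (cyl_line z) $ 2)"
  define c2 where "c2 = (\<lambda>z. u33 (cyl_line z) $ 3)"
  define k2 where "k2 = (\<lambda>z. B33 (cyl_line z) $ 2)"
  define m where "m = (\<lambda>z. c z - z * a z)"
  note defs = a_def b_def c_def k_def q_def a1_def b1_def c1_def k1_def q1_def a2_def b2_def c2_def k2_def m_def

  have B_comp: "B (cyl_line z) $ 1 = 0" "B (cyl_line z) $ 3 = 0" if "z > 0" for z
    using axisymmetric_cyl_point[OF axB, of 1 z 0] that by (simp_all add: cyl_point_def cyl_line_def)
  have momentum: "(1 + z\<^sup>2) * b2 z + 3 * z * b1 z = m z * b1 z"
      "- ((1 + z\<^sup>2) * a2 z + 3 * z * a1 z) + m z * a1 z - (a z)\<^sup>2 - (b z)\<^sup>2 + (k z)\<^sup>2 - (2 * q z + z * q1 z) = 0"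
      "- ((1 + z\<^sup>2) * c2 z + 3 * z * c1 z + c z) + m z * c1 z - a z * c z + q1 z = 0"
    and induction: "(1 + z\<^sup>2) * k2 z + 3 * z * k1 z = m z * k1 z - 2 * a z * k z"
    and divergence_free: "c1 z = z * a1 z"
    if z: "z > 0" for z
  proof -
    let ?x = "cyl_line z"
    have x: "?x \<in> half_space" by (rule cyl_line_half_space[OF z])
    note op_u = operators_cyl_line[OF axu su S hom_u z, folded u3_def, folded u33_def]
    note op_B = operators_cyl_line[OF axB sB S hom_B z, folded B3_def, folded B33_def]
    note op_eq = operators_half_space_eq[OF S x]
    from mhd x have div0: "divergence half_space u ?x = 0"
      and ind0: "- laplacian half_space B ?x + advection half_space u B ?x - advection half_space B u ?x = 0"
      unfolding mhd_system_def by blast+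
    show "c1 z = z * a1 z"
      using div0 by (simp add: op_eq op_u defs)
    from arg_cong[OF ind0, of "\<lambda>v. v $ 2"] show "(1 + z\<^sup>2) * k2 z + 3 * z * k1 z = m z * k1 z - 2 * a z * k z"
      by (simp add: op_eq op_u op_B defs B_comp[OF z] algebra_simps)

    \<comment> \<open>The pressure gradient as solved from the momentum equation; built from
      \<open>u\<close> and \<open>B\<close> only, it inherits their equivariance.\<close>
    define F where "F = (\<lambda>x. laplacian half_space_closed u x - advection half_space_closed u u x
      + advection half_space_closed B B x)"
    have grad: "gradient half_space p y = F y" if "y \<in> half_space" for y
    proof -
      have "- laplacian half_space u y + advection half_space u u y
        - advection half_space B B y + gradient half_space p y = 0"
        using mhd that unfolding mhd_system_def by blast
      then show ?thesis
        unfolding F_def operators_half_space_eq[OF S that] by (simp add: algebra_simps)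
    qed
    have "F (rot \<theta> ?x) = rot \<theta> (F ?x)" for \<theta>
    proof -
      interpret R: bounded_linear "rot \<theta>" by (rule bounded_linear_rot)
      have off: "?x \<in> off_axis" by (rule cyl_line_off_axis[OF z])
      show ?thesis
        unfolding F_def axisymmetric_laplacian_rot[OF axu su S off]
          axisymmetric_advection_rot[OF axu axu su S off] axisymmetric_advection_rot[OF axB axB sB S off]
        by (simp add: R.add R.diff)
    qed
    then have "F ?x $ 2 = 0"
      using grad rot_half_space[OF x] by (intro azimuthal_gradient_zero[OF sp z]) simp
    then show "(1 + z\<^sup>2) * b2 z + 3 * z * b1 z = m z * b1 z"
      by (simp add: F_def op_u op_B defs B_comp[OF z] algebra_simps)
    have "partial half_space 3 p ?x = F ?x $ 3"
      using grad[OF x] by (simp add: gradient_def vec_eq_iff)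
    then show "- ((1 + z\<^sup>2) * c2 z + 3 * z * c1 z + c z) + m z * c1 z - a z * c z + q1 z = 0"
      by (simp add: F_def op_u op_B defs B_comp[OF z] algebra_simps)
    have "partial half_space 1 p ?x = F ?x $ 1"
      using grad[OF x] by (simp add: gradient_def vec_eq_iff)
    \<comment> \<open>Homogeneity trades the pressure derivative transverse to the line for
      \<open>q\<close> and \<open>q1\<close>.\<close>
    moreover have "partial half_space 1 p ?x + z * partial half_space 3 p ?x = - (2 * p ?x)"
      using euler_homogeneous[OF order.refl smooth_on_differentiable[OF sp x] x hom_p] by simp
    ultimately have "F ?x $ 1 + z * q1 z + 2 * q z = 0"
      by (simp add: defs)
    then show "- ((1 + z\<^sup>2) * a2 z + 3 * z * a1 z) + m z * a1 z - (a z)\<^sup>2 - (b z)\<^sup>2 + (k z)\<^sup>2 - (2 * q z + z * q1 z) = 0"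
      by (simp add: F_def op_u op_B defs B_comp[OF z] algebra_simps power2_eq_square)
  qed

  have less: "a z < 1 / 3 + 2 / (3 * (1 + z\<^sup>2))" if z: "z > 0" for z
  proof -
    \<comment> \<open>Scaling (1, 0, z) by \<open>r\<close> puts it on the unit sphere at distance
      \<open>r\<close> from the axis, and homogeneity multiplies the assumed bound by
      \<open>r\<close>.\<close>
    define r where "r = 1 / sqrt (1 + z\<^sup>2)"
    have pos: "1 + z\<^sup>2 > 0" by (simp add: add_pos_nonneg)
    then have r: "r > 0" by (simp add: r_def)
    have r2: "r\<^sup>2 = 1 / (1 + z\<^sup>2)" using pos by (simp add: r_def power_divide)
    have x: "r *\<^sub>R cyl_line z = cyl_point r 0 (r * z)"
      by (simp add: cyl_point_def vec_eq_iff forall_3)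
    have "r\<^sup>2 + (r * z)\<^sup>2 = r\<^sup>2 * (1 + z\<^sup>2)"
      by (simp add: algebra_simps)
    also have "\<dots> = 1" unfolding r2 using pos by simp
    finally have "r\<^sup>2 + (r * z)\<^sup>2 = 1" .
    then have "cyl_point r 0 (r * z) \<in> sphere 0 1 \<inter> half_space"
      using r z by (simp add: cyl_point_in_half_space norm_vec_def L2_set_def sum_3) (simp add: cyl_point_def)
    then have "ur r (r * z) < 1 / (3 * r) + 2 * r / 3"
      by (rule assms(5)[OF r])
    moreover have "a z = r * ur r (r * z)"
      using hom_u[OF r cyl_line_half_space[OF z]] axisymmetric_cyl_point[OF axu r, of "r * z" 0] r z
      by (simp add: a_def x)
    ultimately have "a z < r * (1 / (3 * r) + 2 * r / 3)"
      using r by simp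
    also have "\<dots> = 1 / 3 + 2 / 3 * r\<^sup>2"
      using r by (simp add: field_simps power2_eq_square)
    finally show ?thesis by (simp add: r2)
  qed

  have a_lim: "((\<lambda>z. z\<^sup>2 * a z) \<longlongrightarrow> partial half_space_closed 1 u (horizontal_line 0) $ 1) at_top"
    unfolding a_def by (rule axisymmetric_cyl_line_limit[OF axu su S hom_u]) auto
  have k_lim: "((\<lambda>z. z\<^sup>2 * k z) \<longlongrightarrow> partial half_space_closed 1 B (horizontal_line 0) $ 2) at_top"
    unfolding k_def by (rule axisymmetric_cyl_line_limit[OF axB sB S hom_B]) auto
  \<comment> \<open>\<open>B3\<close> has degree -2, so homogeneity alone gives the rate for
    \<open>k1\<close>, whereas \<open>k\<close> needed the vanishing of \<open>B\<close> on the
    axis.\<close>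
  have hom_B3: "B3 x = \<mu> ^ 2 *\<^sub>R B3 (\<mu> *\<^sub>R x)" if "\<mu> > 0" "x \<in> half_space" for \<mu> x
    using homogeneous_partial[OF S smooth_on_differentiable_half_space[OF sB S] _ that, of 1 3] hom_B
    by (simp add: B3_def power2_eq_square)
  have k1_lim: "((\<lambda>z. z\<^sup>2 * k1 z) \<longlongrightarrow> B3 (horizontal_line 0) $ 2) at_top"
    using tendsto_vec_nth[OF homogeneous_cyl_line_limit[OF sB3 S hom_B3], of 2] by (simp add: k1_def)
  have u_lim: "((\<lambda>z. u (cyl_line z) $ i) \<longlongrightarrow> 0) at_top" for i
  proof (rule tendsto_zero_of_times)
    show "((\<lambda>z. z * u (cyl_line z) $ i) \<longlongrightarrow> u (horizontal_line 0) $ i) at_top"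
      using tendsto_vec_nth[OF homogeneous_cyl_line_limit[OF su S, of 1], of i] hom_u by simp
  qed
  have "((\<lambda>z. z * (z * a z)) \<longlongrightarrow> partial half_space_closed 1 u (horizontal_line 0) $ 1) at_top"
    using a_lim by (simp add: power2_eq_square mult.assoc)
  from tendsto_diff[OF u_lim[of 3] tendsto_zero_of_times[OF this]]
  have m_lim: "(m \<longlongrightarrow> 0) at_top"
    by (simp add: defs)

  have m: "(m has_real_derivative - a z) (at z)" if "z > 0" for z
  proof -
    have "(m has_real_derivative c1 z - (a z + z * a1 z)) (at z)"
      unfolding defs using du[OF that] by (auto intro!: derivative_eq_intros)
    then show ?thesis using divergence_free[OF that] by simp
  qed
  have cont_m: "continuous_on {0..} m"
    unfolding defs by (intro continuous_intros cont su)
  have c0: "c 0 = 0"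
    unfolding defs by (rule velocity_bc_cyl_line(1)[OF assms(4) su])
  have m0: "m 0 = 0"
    using c0 by (simp add: m_def)
  have bc: "a 0 = 0 \<or> a1 0 = 0" "b 0 = 0 \<or> b1 0 = 0"
    unfolding defs u3_def by (rule velocity_bc_cyl_line(2)[OF assms(4) su], simp)+
  have k10: "k1 0 = 0"
    using magnetic_bc_cyl_line[OF _ sB] assms(4)
    by (auto simp: k1_def B3_def no_slip_bc_def navier_slip_bc_def)

  have k0: "k z = 0" if "z > 0" for z
    by (rule magnetic_ode_zero[where m = m and a = a and k = k and ?k1.0 = k1 and ?k2.0 = k2, OF cont_m _ _ m _ _ induction k10 m0 m_lim k_lim k1_lim less that])
      (use cont sB sB3 dB dB3 in \<open>auto simp: k_def k1_def k2_def\<close>)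
  have b0: "b z = 0" if "z > 0" for z
    by (rule swirl_ode_zero[where m = m and b = b and ?b1.0 = b1 and ?b2.0 = b2,
          OF cont_m _ _ _ _ momentum(1) bc(2) _ that])
      (use cont su su3 du du3 u_lim in \<open>auto simp: b_def b1_def b2_def\<close>)
  \<comment> \<open>With \<open>k\<close> and \<open>b\<close> gone, the centrifugal and magnetic
    terms drop out and the equations for \<open>a\<close>, \<open>c\<close> and \<open>q\<close>
    close among themselves.\<close>
  have ac0: "a z = 0 \<and> c z = 0" if "z > 0" for z
  proof (rule navier_stokes_ode_zero[where a = a and ?a1.0 = a1 and ?a2.0 = a2
        and c = c and ?c1.0 = c1 and ?c2.0 = c2 and q = q and ?q1.0 = q1])
    show "(q has_real_derivative q1 z) (at z)" if "z > 0" for z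
      using cyl_line_derivative[OF sp order.refl that]
      by (simp add: q_def q1_def has_real_derivative_iff_has_vector_derivative)
    show "- ((1 + z\<^sup>2) * a2 z + 3 * z * a1 z) + (c z - z * a z) * a1 z - (a z)\<^sup>2 - (2 * q z + z * q1 z) = 0" if "z > 0" for z
      using momentum(2)[OF that] by (simp add: m_def k0[OF that] b0[OF that])
    show "- ((1 + z\<^sup>2) * c2 z + 3 * z * c1 z + c z) + (c z - z * a z) * c1 z - a z * c z + q1 z = 0" if "z > 0" for z
      using momentum(3)[OF that] by (simp add: m_def)
    show "c1 z = z * a1 z" if "z > 0" for z
      by (rule divergence_free[OF that])
    show "a 0 = 0 \<or> a1 0 = 0"
      by (rule bc(1))
  qed (use cont su su3 du du3 u_lim a_lim c0 that in
        \<open>auto simp: a_def a1_def a2_def c_def c1_def c2_def\<close>)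

  have "u (cyl_line z) = 0" "B (cyl_line z) = 0" if "z > 0" for z
    using k0[OF that] b0[OF that] ac0[OF that] B_comp[OF that]
    by (simp_all add: vec_eq_iff forall_3 defs)
  then show ?thesis
    using zero_of_zero_on_cyl_line[OF axu su hom_u] zero_of_zero_on_cyl_line[OF axB sB hom_B] by blast
qed

end
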